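(* Assume the aligned setting, and let $x\in\mathrm{supp}(Q_U)$. Suppose that the Bayes label $y^{\star}(x)\in\arg\max_{y\in\mathscr Y}p_{Y|X}(y\mid x)$ is unique and that $p_{Y|X}(\cdot\mid\cdot)$ is $L$-Lipschitz in its second argument. Then, if $k\to\infty$ and $k/n\to0$ as $n\to\infty$, $$ \Delta\mathscr H(x;\lambda^\star) \;\longrightarrow\; \lambda_\infty(x)\, \big(p_{Y|X}(y^{\star}(x)\mid x)-p_{\rm LM}(y^{\star}(x)\mid x)\big)\quad\text{in probability}, $$ where $\lambda_\infty(x):=\mathbf 1_{\{\ell_{\mathrm{Bayes}}(x)<\ell_{\rm LM}(x)\}}$.
   Context: Let $\mathscr Y=\{1,\ldots,C\}$ be a finite label set and let $\|\cdot\|$ be a norm on $\mathbb R^d$. Let $(X,Y)$ be a random pair in $\mathbb R^d\times\mathscr Y$; $P_X$ is the law of $X$ and $p_{Y|X}(\cdot\mid x)$ the conditional distribution of $Y$ given $X=x$. For each $x$, $p_{\rm LM}(\cdot\mid x)$ is a fixed (non-random, independent of $n$) probability distribution on $\mathscr Y$. The memory consists of i.i.d. pairs $(U_i,V_i)_{i=1}^n$ in $\mathbb R^d\times\mathscr Y$; $Q_U$ is the law of $U_1$, $\mathrm{supp}(Q_U)$ its (closed) support, and $q_{V|U}(\cdot\mid u)$ the conditional distribution of $V_1$ given $U_1=u$. The aligned setting means $P_X=Q_U$ and $p_{Y|X}=q_{V|U}$. "$L$-Lipschitz in its second argument" means $|p_{Y|X}(y\mid u)-p_{Y|X}(y\mid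 u')|\leqslant L\|u-u'\|$ for all $y\in\mathscr Y$ and $u,u'\in\mathbb R^d$, with $L>0$ a constant. The integer $k=k_n$, $1\leqslant k\leqslant n$, is deterministic. For $x\in\mathbb R^d$, $U_{(1)}(x),\ldots,U_{(k)}(x)$ are the $k$ nearest neighbors of $x$ among $U_1,\ldots,U_n$, in order of increasing distance (ties broken by index order), with associated labels $V_{(1)}(x),\ldots,V_{(k)}(x)$. Define - the retriever distribution $\hat r^{(k)}_y(x)=\frac1k\sum_{j=1}^k\mathbf 1_{\{V_{(j)}(x)=y\}}$, $y\in\mathscr Y$; - the retriever's modal label $y_r(x)\in\arg\max_{y\in\mathscr Y}\hat r^{(k)}_y(x)$ (ties broken deterministically); - the retrieval-trust weight $w_{\mathrm{fact}}(x)=\frac1k\sum_{j=1}^k\exp(-\|x-U_{(j)}(x)\|^2)$; - for a gate $\lambda:\mathbb R^d\to[0,1]$, the mixture $p_{{\rm RAG},\lambda}(y\mid x)=(1-\lambda(x))\,p_{\rm LM}(y\mid x)+\lambda(x)\,\hat r^{(k)}_y(x)$; - for a conditional distribution $p(\cdot\mid x)$ on $\mathscr Y$, the discordance score $\mathscr H_{\mathrm{disc}}(p;x)=w_{\mathrm{fact}}(x)\,(1-p(y_r(x)\mid x))$; - the variation $\Delta\mathscr H(x;\lambda)=\mathscr H_{\mathrm{disc}}(p_{\rm LM};x)-\mathscr H_{\mathrm{disc}}(p_{{\rm RAG},\lambda};x)$, which equals $\lambda(x)\,w_{\mathrm{fact}}(x)\,(\hat r^{(k)}_{y_r(x)}(x)-p_{\rm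 LM}(y_r(x)\mid x))$; - the local cross-entropies $\ell_{\rm LM}(x)=\sum_{y}p_{Y|X}(y\mid x)(-\log p_{\rm LM}(y\mid x))$, $\ell_r(x)=\sum_{y}p_{Y|X}(y\mid x)(-\log \hat r^{(k)}_y(x))$, and $\ell_{\mathrm{Bayes}}(x)=\sum_{y}p_{Y|X}(y\mid x)(-\log p_{Y|X}(y\mid x))$, with the conventions $0\log0=0$ (terms with $p_{Y|X}(y\mid x)=0$ contribute $0$) and $-\log 0=+\infty$ when the weight is positive; - for a fixed constant $\zeta\geqslant0$, the optimal hard gate $\lambda^\star(x)=\mathbf 1_{\{\ell_r(x)+\zeta(1-w_{\mathrm{fact}}(x))<\ell_{\rm LM}(x)\}}$. *)

theory Defs
  imports "HOL-Probability.Probability"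
begin

text \<open>
  The norm on the feature space is arbitrary, so it is an explicit function \<open>N\<close> and not
  the Euclidean \<^const>\<open>norm\<close> of \<^typ>\<open>real ^ 'd\<close>; nonnegativity follows from the three clauses.
  All norms induce the same topology, so the \<^const>\<open>borel\<close> sets and the support do not depend on \<open>N\<close>.
\<close>

definition is_norm :: "('a::real_vector \<Rightarrow> real) \<Rightarrow> bool" where
  "is_norm N \<longleftrightarrow>
     (\<forall>x. N x = 0 \<longleftrightarrow> x = 0) \<and>
     (\<forall>a x. N (a *\<^sub>R x) = \<bar>a\<bar> * N x) \<and>
     (\<forall>x y. N (x + y) \<le> N x + N y)"

definition measure_support :: "'a::topological_space measure \<Rightarrow> 'a set" where
  "measure_support Q = {x. \<forall>A. open A \<and> x \<in> A \<longrightarrow> emeasure Q A > 0}"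

definition label_dist :: "nat \<Rightarrow> (nat \<Rightarrow> real) \<Rightarrow> bool" where
  "label_dist C q \<longleftrightarrow> (\<forall>y\<in>{1..C}. 0 \<le> q y) \<and> (\<Sum>y=1..C. q y) = 1"

text \<open>
  Below, \<open>p x y\<close> stands for \<open>p(y | x)\<close>: \<open>p\<close> is a (version of the) regular conditional
  distribution of \<open>Y\<close> given \<open>X\<close>.
\<close>

definition is_cond_dist ::
  "'w measure \<Rightarrow> ('w \<Rightarrow> 'a::topological_space) \<Rightarrow> ('w \<Rightarrow> nat) \<Rightarrow> nat \<Rightarrow> ('a \<Rightarrow> nat \<Rightarrow> real) \<Rightarrow> bool" where
  "is_cond_dist M X Y C p \<longleftrightarrow>
     (\<forall>x. label_dist C (p x)) \<and>
     (\<forall>y\<in>{1..C}. (\<lambda>x. p x y) \<in> borel_measurable borel) \<and>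
     (\<forall>y\<in>{1..C}. \<forall>A\<in>sets borel.
        measure M {\<omega>\<in>space M. X \<omega> \<in> A \<and> Y \<omega> = y} = (LINT x:A|distr M borel X. p x y))"

definition lipschitz_cond :: "('a::real_vector \<Rightarrow> real) \<Rightarrow> nat \<Rightarrow> real \<Rightarrow> ('a \<Rightarrow> nat \<Rightarrow> real) \<Rightarrow> bool" where
  "lipschitz_cond N C L p \<longleftrightarrow>
     (\<forall>y\<in>{1..C}. \<forall>u u'. \<bar>p u y - p u' y\<bar> \<le> L * N (u - u'))"

text \<open>
  A memory of size \<open>n\<close> consists of \<open>(u i, v i)\<close> for \<open>i < n\<close>, and the neighbours of a point are
  numbered from \<open>0\<close>. As \<^const>\<open>sort_key\<close> is stable, equal distances are ordered by index.
\<close>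

definition nn_index :: "('a::real_vector \<Rightarrow> real) \<Rightarrow> nat \<Rightarrow> (nat \<Rightarrow> 'a) \<Rightarrow> 'a \<Rightarrow> nat \<Rightarrow> nat" where
  "nn_index N n u x j = sort_key (\<lambda>i. N (x - u i)) [0..<n] ! j"

definition retriever ::
  "('a::real_vector \<Rightarrow> real) \<Rightarrow> nat \<Rightarrow> nat \<Rightarrow> (nat \<Rightarrow> 'a) \<Rightarrow> (nat \<Rightarrow> nat) \<Rightarrow> 'a \<Rightarrow> nat \<Rightarrow> real" where
  "retriever N n k u v x y = (\<Sum>j<k. of_bool (v (nn_index N n u x j) = y)) / real k"

definition trust_weight ::
  "('a::real_vector \<Rightarrow> real) \<Rightarrow> nat \<Rightarrow> nat \<Rightarrow> (nat \<Rightarrow> 'a) \<Rightarrow> 'a \<Rightarrow> real" where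
  "trust_weight N n k u x = (\<Sum>j<k. exp (- (N (x - u (nn_index N n u x j)))\<^sup>2)) / real k"

definition modal_labels :: "nat \<Rightarrow> (nat \<Rightarrow> real) \<Rightarrow> nat set" where
  "modal_labels C q = {y. is_arg_max q (\<lambda>y. y \<in> {1..C}) y}"

text \<open>
  A deterministic tie-breaking rule selects one element from each nonempty set of tied labels.
\<close>

definition tie_breaker :: "nat \<Rightarrow> (nat set \<Rightarrow> nat) \<Rightarrow> bool" where
  "tie_breaker C sel \<longleftrightarrow> (\<forall>S. S \<subseteq> {1..C} \<and> S \<noteq> {} \<longrightarrow> sel S \<in> S)"

definition rag_mixture ::
  "('a \<Rightarrow> real) \<Rightarrow> ('a \<Rightarrow> nat \<Rightarrow> real) \<Rightarrow> ('a \<Rightarrow> nat \<Rightarrow> real) \<Rightarrow> 'a \<Rightarrow> nat \<Rightarrow> real" where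
  "rag_mixture lam pLM r x y = (1 - lam x) * pLM x y + lam x * r x y"

definition disc_score ::
  "('a::real_vector \<Rightarrow> real) \<Rightarrow> nat \<Rightarrow> (nat set \<Rightarrow> nat) \<Rightarrow> nat \<Rightarrow> nat \<Rightarrow> (nat \<Rightarrow> 'a) \<Rightarrow> (nat \<Rightarrow> nat)
     \<Rightarrow> ('a \<Rightarrow> nat \<Rightarrow> real) \<Rightarrow> 'a \<Rightarrow> real" where
  "disc_score N C sel n k u v p x =
     trust_weight N n k u x * (1 - p x (sel (modal_labels C (retriever N n k u v x))))"

definition disc_variation ::
  "('a::real_vector \<Rightarrow> real) \<Rightarrow> nat \<Rightarrow> (nat set \<Rightarrow> nat) \<Rightarrow> nat \<Rightarrow> nat \<Rightarrow> (nat \<Rightarrow> 'a) \<Rightarrow> (nat \<Rightarrow> nat)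
     \<Rightarrow> ('a \<Rightarrow> nat \<Rightarrow> real) \<Rightarrow> ('a \<Rightarrow> real) \<Rightarrow> 'a \<Rightarrow> real" where
  "disc_variation N C sel n k u v pLM lam x =
     disc_score N C sel n k u v pLM x -
     disc_score N C sel n k u v (rag_mixture lam pLM (retriever N n k u v)) x"

definition neg_log :: "real \<Rightarrow> ereal" where
  "neg_log t = (if t = 0 then \<infinity> else ereal (- ln t))"

text \<open>
  In \<^typ>\<open>ereal\<close> we have \<open>0 * \<infinity> = 0\<close>, so labels of weight \<open>0\<close> contribute \<open>0\<close>, and labels of
  positive weight with \<open>q y = 0\<close> contribute \<open>\<infinity>\<close>.
\<close>

definition cross_entropy :: "nat \<Rightarrow> (nat \<Rightarrow> real) \<Rightarrow> (nat \<Rightarrow> real) \<Rightarrow> ereal" where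
  "cross_entropy C p q = (\<Sum>y=1..C. ereal (p y) * neg_log (q y))"

definition opt_gate ::
  "('a::real_vector \<Rightarrow> real) \<Rightarrow> nat \<Rightarrow> real \<Rightarrow> nat \<Rightarrow> nat \<Rightarrow> (nat \<Rightarrow> 'a) \<Rightarrow> (nat \<Rightarrow> nat)
     \<Rightarrow> ('a \<Rightarrow> nat \<Rightarrow> real) \<Rightarrow> ('a \<Rightarrow> nat \<Rightarrow> real) \<Rightarrow> 'a \<Rightarrow> real" where
  "opt_gate N C \<zeta> n k u v p pLM x =
     of_bool (cross_entropy C (p x) (retriever N n k u v x)
                + ereal (\<zeta> * (1 - trust_weight N n k u x))
              < cross_entropy C (p x) (pLM x))"

definition limit_gate ::
  "nat \<Rightarrow> ('a \<Rightarrow> nat \<Rightarrow> real) \<Rightarrow> ('a \<Rightarrow> nat \<Rightarrow> real) \<Rightarrow> 'a \<Rightarrow> real" where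
  "limit_gate C p pLM x =
     of_bool (cross_entropy C (p x) (p x) < cross_entropy C (p x) (pLM x))"

text \<open>
  Measurability is part of the definition since \<^const>\<open>measure\<close> is \<open>0\<close> on non-measurable sets.
\<close>

definition tendsto_in_prob :: "'w measure \<Rightarrow> (nat \<Rightarrow> 'w \<Rightarrow> real) \<Rightarrow> real \<Rightarrow> bool" where
  "tendsto_in_prob M Z c \<longleftrightarrow>
     (\<forall>n. Z n \<in> borel_measurable M) \<and>
     (\<forall>\<epsilon>>0. (\<lambda>n. measure M {\<omega>\<in>space M. \<bar>Z n \<omega> - c\<bar> > \<epsilon>}) \<longlonglongrightarrow> 0)"

end

theory Submission
  imports Defs
begin

text \<open>
  The variation of the discordance score under the optimal gate is a fixed functional
  \<open>gated_gain\<close> of two random quantities: the frequencies \<open>r\<close> of the retrieved labels and the trust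
  weight \<open>w\<close>. The theorem holds because \<open>r\<close> converges in probability to \<open>p(\<cdot> | x)\<close>, \<open>w\<close> converges
  in probability to \<open>1\<close>, and the functional is continuous at \<open>(p(\<cdot> | x), 1)\<close>.

  Continuity (\<open>gated_gain_continuous\<close>): near the limit the modal label is the Bayes label, since that label
  is unique. The cross-entropy against \<open>r\<close> tends to the entropy of \<open>p(\<cdot> | x)\<close> and the penalty
  \<open>\<zeta> * (1 - w)\<close> vanishes. So the gate settles if the Bayes cross-entropy is strictly below that
  of the language model. Otherwise the strict form of Gibbs' inequality (\<open>gibbs_strict\<close>) makes the language
  model agree with \<open>p(\<cdot> | x)\<close> at the Bayes label, and the gated quantity tends to \<open>0\<close> whatever the
  gate does.

  Locality: as \<open>x\<close> is in the support, every ball around it has positive mass \<open>\<pi>\<close>, so it contains about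
  \<open>n * \<pi>\<close> points of the memory, far more than \<open>k\<close> (\<open>few_hits_prob_tendsto_0\<close>). All \<open>k\<close>
  neighbours then lie in the ball (\<open>neighbours_in_ball\<close>). This gives \<open>w \<rightarrow> 1\<close> and, by the Lipschitz
  condition, makes the average of \<open>p(y | U)\<close> over the neighbours close to \<open>p(y | x)\<close>.

  Concentration: the neighbours are chosen by looking at positions only, so given the positions their
  labels are independent with laws \<open>p(\<cdot> | U)\<close>. The label frequencies thus differ from the averages above by
  an error of second moment at most \<open>1 / k\<close> (\<open>selected_sum_second_moment\<close>,
  \<open>retriever_concentration\<close>).
\<close>

section \<open>Cross-entropy and Gibbs' inequality\<close>

lemma cross_entropy_eq_sum:
  assumes "\<And>y. y \<in> {1..C} \<Longrightarrow> 0 \<le> p y"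
    and "\<And>y. y \<in> {1..C} \<Longrightarrow> 0 < p y \<Longrightarrow> q y \<noteq> 0"
  shows "cross_entropy C p q = ereal (\<Sum>y=1..C. p y * - ln (q y))"
proof -
  have "ereal (p y) * neg_log (q y) = ereal (p y * - ln (q y))" if "y \<in> {1..C}" for y
    using assms(1)[OF that] assms(2)[OF that] by (cases "p y = 0") (auto simp: neg_log_def)
  then show ?thesis
    unfolding cross_entropy_def by (simp flip: sum_ereal)
qed

lemma cross_entropy_eq_infinity:
  assumes "y \<in> {1..C}" "0 < p y" "q y = 0"
  shows "cross_entropy C p q = \<infinity>"
  unfolding cross_entropy_def sum_Pinfty
  using assms by (intro conjI bexI[of _ y]) (auto simp: neg_log_def)

text \<open>
  The excess of the cross-entropy over the entropy is a sum of terms \<open>p y * ln (p y / q y)\<close>, and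
  \<open>ln t \<le> t - 1\<close>, with equality only at \<open>t = 1\<close>, bounds each of them below by \<open>p y - q y\<close>; these
  bounds add up to \<open>0\<close>. The labels \<open>y\<close> with \<open>p y = 0\<close> contribute \<open>0 \<ge> - q y\<close>, so a deficit there cannot
  compensate for a strict inequality elsewhere.
\<close>

lemma gibbs_strict:
  assumes p: "label_dist C p" and q: "label_dist C q"
    and le: "\<not> cross_entropy C p p < cross_entropy C p q"
    and y: "y \<in> {1..C}" "0 < p y"
  shows "q y = p y"
proof (rule ccontr)
  assume ne: "q y \<noteq> p y"
  have p0: "\<And>y. y \<in> {1..C} \<Longrightarrow> 0 \<le> p y" and q0: "\<And>y. y \<in> {1..C} \<Longrightarrow> 0 \<le> q y"
    and sums: "(\<Sum>y=1..C. p y) = 1" "(\<Sum>y=1..C. q y) = 1"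
    using p q by (auto simp: label_dist_def)
  have pp: "cross_entropy C p p = ereal (\<Sum>y=1..C. p y * - ln (p y))"
    using p0 by (intro cross_entropy_eq_sum) auto
  have supp: "q z \<noteq> 0" if "z \<in> {1..C}" "0 < p z" for z
  proof
    assume "q z = 0"
    with that have "cross_entropy C p q = \<infinity>"
      by (rule cross_entropy_eq_infinity)
    with le show False
      unfolding pp by simp
  qed
  have pq: "cross_entropy C p q = ereal (\<Sum>y=1..C. p y * - ln (q y))"
    using p0 supp by (intro cross_entropy_eq_sum) auto
  have term_le: "p z * ln (q z) - p z * ln (p z) \<le> q z - p z" if z: "z \<in> {1..C}" for z
  proof (cases "p z = 0")
    case False
    then have pos: "0 < p z" "0 < q z"
      using p0[OF z] q0[OF z] supp[OF z] by auto
    have "p z * ln (q z / p z) \<le> p z * (q z / p z - 1)"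
      using pos by (intro mult_left_mono ln_le_minus_one) auto
    then show ?thesis
      using pos by (simp add: ln_div right_diff_distrib)
  qed (use q0[OF z] in auto)
  have pos: "0 < p y" "0 < q y"
    using y q0[OF y(1)] supp[OF y] by auto
  have "ln (q y / p y) < q y / p y - 1"
    using ln_eq_minus_one[of "q y / p y"] ln_le_minus_one[of "q y / p y"] pos ne
    by (fastforce simp: less_le)
  then have "p y * ln (q y / p y) < p y * (q y / p y - 1)"
    using pos by simp
  then have "p y * ln (q y) - p y * ln (p y) < q y - p y"
    using pos by (simp add: ln_div right_diff_distrib)
  then have "(\<Sum>z=1..C. p z * ln (q z) - p z * ln (p z)) < (\<Sum>z=1..C. q z - p z)"
    by (intro sum_strict_mono_ex1 ballI bexI[OF _ y(1)] term_le) simp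
  also have "\<dots> = 0"
    by (simp only: sum_subtractf sums diff_self)
  finally have "(\<Sum>z=1..C. p z * ln (q z)) < (\<Sum>z=1..C. p z * ln (p z))"
    by (simp only: sum_subtractf diff_less_0_iff_less)
  then have "(\<Sum>z=1..C. p z * - ln (p z)) < (\<Sum>z=1..C. p z * - ln (q z))"
    by (simp only: mult_minus_right sum_negf neg_less_iff_less)
  then have "cross_entropy C p p < cross_entropy C p q"
    unfolding pp pq by (simp only: less_ereal.simps)
  then show False
    using le by contradiction
qed

section \<open>Continuity of the gated gain\<close>

text \<open>
  The variation under the optimal gate depends on the memory only through the retriever frequencies
  \<open>r\<close> and the trust weight \<open>w\<close>. Isolating this dependence separates the probabilistic statement
  (\<open>r\<close> and \<open>w\<close> converge) from the analytic one (the functional is continuous at the limit).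
\<close>

definition gated_gain ::
  "nat \<Rightarrow> (nat set \<Rightarrow> nat) \<Rightarrow> real \<Rightarrow> (nat \<Rightarrow> real) \<Rightarrow> (nat \<Rightarrow> real) \<Rightarrow> (nat \<Rightarrow> real) \<Rightarrow> real \<Rightarrow> real" where
  "gated_gain C sel \<zeta> p q r w =
     (let m = sel (modal_labels C r)
      in of_bool (cross_entropy C p r + ereal (\<zeta> * (1 - w)) < cross_entropy C p q) * w * (r m - q m))"

lemma disc_variation_opt_gate:
  "disc_variation N C sel n k u v pLM (opt_gate N C \<zeta> n k u v p pLM) x
     = gated_gain C sel \<zeta> (p x) (pLM x) (retriever N n k u v x) (trust_weight N n k u x)"
  by (simp add: disc_variation_def disc_score_def rag_mixture_def opt_gate_def gated_gain_def
      Let_def algebra_simps)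

lemma modal_labels_eventually:
  assumes modal: "{y. is_arg_max p (\<lambda>y. y \<in> {1..C}) y} = {m}"
    and r: "\<And>y. y \<in> {1..C} \<Longrightarrow> ((\<lambda>a. r a y) \<longlongrightarrow> p y) F"
  shows "eventually (\<lambda>a. modal_labels C (r a) = {m}) F"
proof -
  have m: "m \<in> {1..C}" and max: "\<And>z. z \<in> {1..C} \<Longrightarrow> p z \<le> p m"
    using modal by (auto simp: is_arg_max_linorder set_eq_iff)
  have gap: "p z < p m" if z: "z \<in> {1..C}" "z \<noteq> m" for z
  proof (rule ccontr)
    assume "\<not> p z < p m"
    then have "is_arg_max p (\<lambda>y. y \<in> {1..C}) z"
      using max z by (force simp: is_arg_max_linorder)
    then show False
      using modal z by blast
  qed
  have "eventually (\<lambda>a. \<forall>z\<in>{1..C} - {m}. r a z < r a m) F"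
  proof (intro eventually_ball_finite ballI)
    fix z assume z: "z \<in> {1..C} - {m}"
    then have "((\<lambda>a. r a m - r a z) \<longlongrightarrow> p m - p z) F"
      using m by (intro tendsto_diff r) auto
    then have "eventually (\<lambda>a. 0 < r a m - r a z) F"
      using gap z by (intro order_tendstoD) auto
    then show "eventually (\<lambda>a. r a z < r a m) F"
      by eventually_elim simp
  qed auto
  then show ?thesis
  proof eventually_elim
    case (elim a)
    have "is_arg_max (r a) (\<lambda>y. y \<in> {1..C}) z \<longleftrightarrow> z = m" for z
    proof
      assume z: "is_arg_max (r a) (\<lambda>y. y \<in> {1..C}) z"
      then have "z \<in> {1..C}" "\<not> r a z < r a m"
        using m by (auto simp: is_arg_max_def)
      then show "z = m"
        using elim by blast
    next
      assume "z = m"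
      moreover have "\<not> r a m < r a y" if "y \<in> {1..C}" for y
        using elim that by (cases "y = m") (auto dest: less_imp_le simp: not_less)
      ultimately show "is_arg_max (r a) (\<lambda>y. y \<in> {1..C}) z"
        using m by (simp add: is_arg_max_def)
    qed
    then show ?case
      by (simp add: modal_labels_def)
  qed
qed

text \<open>
  Although the cross-entropy jumps to \<open>\<infinity>\<close> where a retrieved frequency vanishes, it is continuous at
  \<open>r = p\<close>: near this point the frequencies of all labels in the support of \<open>p\<close> are positive, and the
  other labels have weight \<open>0\<close>.
\<close>

lemma cross_entropy_tendsto:
  assumes p: "\<And>y. y \<in> {1..C} \<Longrightarrow> 0 \<le> p y"
    and r: "\<And>y. y \<in> {1..C} \<Longrightarrow> ((\<lambda>a. r a y) \<longlongrightarrow> p y) F"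
  shows "((\<lambda>a. cross_entropy C p (r a)) \<longlongrightarrow> cross_entropy C p p) F"
proof -
  have "eventually (\<lambda>a. \<forall>y\<in>{y\<in>{1..C}. 0 < p y}. 0 < r a y) F"
    by (intro eventually_ball_finite) (auto intro!: order_tendstoD(1)[OF r])
  then have ev: "eventually (\<lambda>a. ereal (\<Sum>y=1..C. p y * - ln (r a y)) = cross_entropy C p (r a)) F"
  proof eventually_elim
    case (elim a)
    then have "\<And>y. y \<in> {1..C} \<Longrightarrow> 0 < p y \<Longrightarrow> r a y \<noteq> 0"
      by force
    then show ?case
      using p by (intro cross_entropy_eq_sum[symmetric])
  qed
  have "((\<lambda>a. p y * - ln (r a y)) \<longlongrightarrow> p y * - ln (p y)) F" if y: "y \<in> {1..C}" for y
    by (cases "p y = 0") (auto intro!: tendsto_intros r[OF y])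
  then have "((\<lambda>a. ereal (\<Sum>y=1..C. p y * - ln (r a y))) \<longlongrightarrow> ereal (\<Sum>y=1..C. p y * - ln (p y))) F"
    by (intro tendsto_ereal tendsto_sum)
  moreover have "ereal (\<Sum>y=1..C. p y * - ln (p y)) = cross_entropy C p p"
    using p by (intro cross_entropy_eq_sum[symmetric]) auto
  ultimately show ?thesis
    using ev by (simp only: Lim_transform_eventually)
qed

text \<open>
  The gate itself is sure to converge only when the two limiting cross-entropies differ. If they agree,
  the gate may oscillate forever, but then \<open>gibbs_strict\<close> forces \<open>q m = p m\<close>, so that the factor \<open>r m - q m\<close>
  behind the gate tends to \<open>0\<close>, which is also the value of the limit.
\<close>

lemma gated_gain_tendsto:
  assumes p: "label_dist C p" and q: "label_dist C q" and tie: "tie_breaker C sel"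
    and modal: "{y. is_arg_max p (\<lambda>y. y \<in> {1..C}) y} = {m}"
    and r: "\<And>y. y \<in> {1..C} \<Longrightarrow> ((\<lambda>a. r a y) \<longlongrightarrow> p y) F"
    and w: "(w \<longlongrightarrow> 1) F"
  shows "((\<lambda>a. gated_gain C sel \<zeta> p q (r a) (w a))
           \<longlongrightarrow> of_bool (cross_entropy C p p < cross_entropy C p q) * (p m - q m)) F"
proof -
  define gate where
    "gate a = (of_bool (cross_entropy C p (r a) + ereal (\<zeta> * (1 - w a)) < cross_entropy C p q) :: real)" for a
  define gate\<^sub>0 where "gate\<^sub>0 = (of_bool (cross_entropy C p p < cross_entropy C p q) :: real)"
  have m: "m \<in> {1..C}" and max: "\<And>z. z \<in> {1..C} \<Longrightarrow> p z \<le> p m"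
    using modal by (auto simp: is_arg_max_linorder set_eq_iff)
  have p0: "\<And>y. y \<in> {1..C} \<Longrightarrow> 0 \<le> p y" and p1: "(\<Sum>y=1..C. p y) = 1"
    using p by (auto simp: label_dist_def)
  \<comment> \<open>Gibbs equality gives information only on the support of \<open>p\<close>, which contains the mode.\<close>
  have pm: "0 < p m"
  proof (rule ccontr)
    assume "\<not> 0 < p m"
    then have "(\<Sum>y=1..C. p y) \<le> (\<Sum>y=1..C. 0)"
      using max by (intro sum_mono) force
    then show False
      using p1 by simp
  qed
  have "{m} \<subseteq> {1..C}" "{m} \<noteq> {}"
    using m by auto
  then have sel: "sel {m} = m"
    using tie unfolding tie_breaker_def by blast
  have "eventually (\<lambda>a. gate a * (w a * (r a m - q m)) = gated_gain C sel \<zeta> p q (r a) (w a)) F"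
  proof -
    have "eventually (\<lambda>a. modal_labels C (r a) = {m}) F"
      by (rule modal_labels_eventually[OF modal r])
    then show ?thesis
      by eventually_elim (simp add: sel gated_gain_def gate_def Let_def)
  qed
  moreover have "((\<lambda>a. gate a * (w a * (r a m - q m))) \<longlongrightarrow> gate\<^sub>0 * (p m - q m)) F"
  proof (cases "cross_entropy C p p < cross_entropy C p q")
    case True
    have pp: "cross_entropy C p p = ereal (\<Sum>y=1..C. p y * - ln (p y))"
      using p0 by (intro cross_entropy_eq_sum) auto
    have "((\<lambda>a. ereal (\<zeta> * (1 - w a))) \<longlongrightarrow> ereal (\<zeta> * (1 - 1))) F"
      by (intro tendsto_intros w)
    then have "((\<lambda>a. cross_entropy C p (r a) + ereal (\<zeta> * (1 - w a)))
                 \<longlongrightarrow> cross_entropy C p p + ereal (\<zeta> * (1 - 1))) F"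
      using pp by (intro tendsto_add_ereal cross_entropy_tendsto p0 r) auto
    then have "eventually (\<lambda>a. cross_entropy C p (r a) + ereal (\<zeta> * (1 - w a)) < cross_entropy C p q) F"
      using True by (intro order_tendstoD(2)[where y = "cross_entropy C p p + ereal (\<zeta> * (1 - 1))"]) (auto simp: zero_ereal_def[symmetric])
    then have "eventually (\<lambda>a. 1 = gate a) F"
      by eventually_elim (simp add: gate_def)
    then have "(gate \<longlongrightarrow> 1) F"
      by (rule Lim_transform_eventually[OF tendsto_const])
    then have "((\<lambda>a. gate a * (w a * (r a m - q m))) \<longlongrightarrow> 1 * (1 * (p m - q m))) F"
      by (intro tendsto_intros w r m)
    then show ?thesis
      using True by (simp add: gate\<^sub>0_def)
  next
    case False
    then have qm: "q m = p m"
      using gibbs_strict[OF p q _ m pm] by simp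
    have "((\<lambda>a. w a * (r a m - q m)) \<longlongrightarrow> 1 * (p m - q m)) F"
      by (intro tendsto_intros w r m)
    then have "((\<lambda>a. w a * (r a m - q m)) \<longlongrightarrow> 0) F"
      by (simp add: qm)
    moreover have "eventually (\<lambda>a. norm (gate a * (w a * (r a m - q m))) \<le> norm (w a * (r a m - q m)) * 1) F"
      by (intro always_eventually) (auto simp: gate_def)
    ultimately have "((\<lambda>a. gate a * (w a * (r a m - q m))) \<longlongrightarrow> 0) F"
      by (rule tendsto_0_le)
    then show ?thesis
      by (simp add: qm)
  qed
  ultimately show ?thesis
    unfolding gate\<^sub>0_def by (rule Lim_transform_eventually[rotated])
qed

text \<open>
  Convergence in probability needs the preceding limit in quantitative form. If no \<open>\<delta>\<close> worked, picking a
  bad point for each \<open>\<delta> = 1 / (i + 1)\<close> would give a sequence that contradicts \<open>gated_gain_tendsto\<close>.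
\<close>

lemma gated_gain_continuous:
  assumes p: "label_dist C p" and q: "label_dist C q" and tie: "tie_breaker C sel"
    and modal: "{y. is_arg_max p (\<lambda>y. y \<in> {1..C}) y} = {m}"
    and \<epsilon>: "0 < \<epsilon>"
  shows "\<exists>\<delta>>0. \<forall>r w. (\<forall>y\<in>{1..C}. \<bar>r y - p y\<bar> \<le> \<delta>) \<and> \<bar>w - 1\<bar> \<le> \<delta> \<longrightarrow>
     \<bar>gated_gain C sel \<zeta> p q r w - of_bool (cross_entropy C p p < cross_entropy C p q) * (p m - q m)\<bar> \<le> \<epsilon>"
proof -
  define c :: real where "c = of_bool (cross_entropy C p p < cross_entropy C p q) * (p m - q m)"
  define near where "near \<delta> r w \<longleftrightarrow> (\<forall>y\<in>{1..C}. \<bar>r y - p y\<bar> \<le> \<delta>) \<and> \<bar>w - 1\<bar> \<le> \<delta>" for \<delta> r w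
  define far where "far r w \<longleftrightarrow> \<bar>gated_gain C sel \<zeta> p q r w - c\<bar> > \<epsilon>" for r w
  have "\<exists>\<delta>>0. \<forall>r w. near \<delta> r w \<longrightarrow> \<not> far r w"
  proof (rule ccontr)
    assume "\<not> (\<exists>\<delta>>0. \<forall>r w. near \<delta> r w \<longrightarrow> \<not> far r w)"
    then have bad: "\<exists>r w. near \<delta> r w \<and> far r w" if "0 < \<delta>" for \<delta>
      using that by blast
    have "\<exists>r w. near (inverse (real (Suc i))) r w \<and> far r w" for i
      by (rule bad) simp
    then obtain r w where rw: "\<And>i. near (inverse (real (Suc i))) (r i) (w i)" and far: "\<And>i. far (r i) (w i)"
      by metis
    have conv: "g \<longlonglongrightarrow> l" if "\<And>i. \<bar>g i - l\<bar> \<le> inverse (real (Suc i))" for g :: "nat \<Rightarrow> real" and l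
    proof (rule Lim_null_comparison[THEN LIM_zero_cancel])
      show "eventually (\<lambda>i. norm (g i - l) \<le> inverse (real (Suc i))) sequentially"
        using that by simp
    qed (rule LIMSEQ_inverse_real_of_nat)
    have near: "\<bar>r i y - p y\<bar> \<le> inverse (real (Suc i))" if "y \<in> {1..C}" for i y
      using rw[of i] that unfolding near_def by blast
    have "(\<lambda>i. r i y) \<longlonglongrightarrow> p y" if "y \<in> {1..C}" for y
      by (rule conv) (rule near[OF that])
    moreover have "w \<longlonglongrightarrow> 1"
      by (rule conv) (rule rw[unfolded near_def, THEN conjunct2])
    ultimately have "(\<lambda>i. gated_gain C sel \<zeta> p q (r i) (w i)) \<longlonglongrightarrow> c"
      unfolding c_def by (intro gated_gain_tendsto p q tie modal)
    then have "eventually (\<lambda>i. dist (gated_gain C sel \<zeta> p q (r i) (w i)) c < \<epsilon>) sequentially"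
      using \<epsilon> by (rule tendstoD)
    from eventually_happens'[OF sequentially_bot this]
    obtain i where "dist (gated_gain C sel \<zeta> p q (r i) (w i)) c < \<epsilon>" ..
    with far[of i] show False
      unfolding far_def dist_real_def by linarith
  qed
  then obtain \<delta> where \<delta>: "0 < \<delta>" "\<And>r w. near \<delta> r w \<Longrightarrow> \<not> far r w"
    by blast
  show ?thesis
  proof (rule exI[of _ \<delta>], intro conjI allI impI)
    fix r w
    assume "(\<forall>y\<in>{1..C}. \<bar>r y - p y\<bar> \<le> \<delta>) \<and> \<bar>w - 1\<bar> \<le> \<delta>"
    then have "\<not> far r w"
      using \<delta>(2) unfolding near_def by blast
    then show "\<bar>gated_gain C sel \<zeta> p q r w
        - of_bool (cross_entropy C p p < cross_entropy C p q) * (p m - q m)\<bar> \<le> \<epsilon>"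
      unfolding far_def c_def not_less .
  qed (rule \<delta>(1))
qed

section \<open>Nearest neighbours and their measurability\<close>

lemma continuous_on_is_norm:
  fixes N :: "'a::euclidean_space \<Rightarrow> real"
  assumes "is_norm N"
  shows "continuous_on UNIV N"
proof (rule convex_on_continuous)
  have tri: "N (a + b) \<le> N a + N b" and scale: "N (t *\<^sub>R a) = \<bar>t\<bar> * N a" for t a b
    using assms by (auto simp: is_norm_def)
  show "convex_on UNIV N"
  proof (rule convex_onI)
    fix t :: real and a b :: 'a
    assume "0 < t" "t < 1"
    then show "N ((1 - t) *\<^sub>R a + t *\<^sub>R b) \<le> (1 - t) * N a + t * N b"
      using tri[of "(1 - t) *\<^sub>R a" "t *\<^sub>R b"] by (simp add: scale)
  qed auto
qed auto

lemma is_norm_nonneg: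
  assumes "is_norm N"
  shows "0 \<le> N a"
proof -
  have "N (a + (-1) *\<^sub>R a) \<le> N a + N ((-1) *\<^sub>R a)" "N ((-1) *\<^sub>R a) = \<bar>-1\<bar> * N a" "N 0 = 0"
    using assms unfolding is_norm_def by blast+
  then show ?thesis
    by simp
qed

lemma insort_key_cong:
  assumes "\<And>i. i \<in> insert a (set xs) \<Longrightarrow> f i = g i"
  shows "insort_key f a xs = insort_key g a xs"
  using assms by (induction xs) auto

lemma sort_key_cong:
  assumes "\<And>i. i \<in> set xs \<Longrightarrow> f i = g i"
  shows "sort_key f xs = sort_key g xs"
  using assms
proof (induction xs)
  case (Cons a xs)
  then show ?case
    by (auto intro!: insort_key_cong)
qed simp

lemma nn_index_cong:
  assumes "\<And>i. i < n \<Longrightarrow> u i = u' i"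
  shows "nn_index N n u x = nn_index N n u' x"
  unfolding nn_index_def
  by (rule ext, rule arg_cong[where f = "\<lambda>l. l ! _"], rule sort_key_cong) (auto simp: assms)

lemma bij_betw_nn_index: "bij_betw (nn_index N n u x) {..<n} {..<n}"
proof -
  have "bij_betw ((!) (sort_key (\<lambda>i. N (x - u i)) [0..<n])) {..<n} {..<n}"
    by (rule bij_betw_nth) (auto simp: lessThan_atLeast0)
  then show ?thesis
    by (simp add: nn_index_def[abs_def])
qed

lemma nn_index_mono:
  assumes "i \<le> j" "j < n"
  shows "N (x - u (nn_index N n u x i)) \<le> N (x - u (nn_index N n u x j))"
proof -
  have "sorted (map (\<lambda>i. N (x - u i)) (sort_key (\<lambda>i. N (x - u i)) [0..<n]))"
    by simp
  from sorted_nth_mono[OF this, of i j] show ?thesis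
    using assms by (simp add: nn_index_def)
qed

text \<open>
  Sums over the \<open>k\<close> nearest neighbours do not depend on their order; the set form allows exchanging them
  with sums over the whole memory.
\<close>

definition neighbours :: "('a::real_vector \<Rightarrow> real) \<Rightarrow> nat \<Rightarrow> nat \<Rightarrow> 'a \<Rightarrow> (nat \<Rightarrow> 'a) \<Rightarrow> nat set" where
  "neighbours N n k x u = nn_index N n u x ` {..<k}"

lemma neighbours_subset: "k \<le> n \<Longrightarrow> neighbours N n k x u \<subseteq> {..<n}"
  using bij_betw_imp_surj_on[OF bij_betw_nn_index[of N n u x]]
  by (auto simp: neighbours_def)

lemma inj_on_nn_index: "k \<le> n \<Longrightarrow> inj_on (nn_index N n u x) {..<k}"
  by (rule inj_on_subset[OF bij_betw_imp_inj_on[OF bij_betw_nn_index]]) auto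

lemma card_neighbours: "k \<le> n \<Longrightarrow> card (neighbours N n k x u) = k"
  unfolding neighbours_def by (simp add: card_image inj_on_nn_index)

lemma sum_neighbours:
  "k \<le> n \<Longrightarrow> (\<Sum>j<k. h (nn_index N n u x j)) = (\<Sum>i\<in>neighbours N n k x u. h i)"
  unfolding neighbours_def by (simp add: sum.reindex[OF inj_on_nn_index] o_def)

text \<open>
  If the neighbour of rank \<open>j < k\<close> were outside the ball, all points of the ball would have rank below
  \<open>j\<close>, hence would be fewer than \<open>k\<close>.
\<close>

lemma neighbours_in_ball:
  assumes "k \<le> n" and card: "k \<le> card {i. i < n \<and> N (x - u i) < r}"
    and i: "i \<in> neighbours N n k x u"
  shows "N (x - u i) < r"
proof (rule ccontr)
  assume far: "\<not> N (x - u i) < r"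
  obtain j where j: "j < k" "i = nn_index N n u x j"
    using i by (auto simp: neighbours_def)
  have "{i. i < n \<and> N (x - u i) < r} \<subseteq> nn_index N n u x ` {..<j}"
  proof
    fix a assume a: "a \<in> {i. i < n \<and> N (x - u i) < r}"
    then have "a \<in> nn_index N n u x ` {..<n}"
      using bij_betw_imp_surj_on[OF bij_betw_nn_index[of N n u x]] by simp
    then obtain l where l: "l < n" "a = nn_index N n u x l"
      by auto
    have "\<not> j \<le> l"
      using nn_index_mono[of j l n N x u] far a j l by auto
    then show "a \<in> nn_index N n u x ` {..<j}"
      using l by auto
  qed
  then have "card {i. i < n \<and> N (x - u i) < r} \<le> card {..<j}"
    by (rule surj_card_le[rotated]) simp
  then show False
    using card j by simp
qed

lemma measurable_insort_key:
  fixes f :: "'w \<Rightarrow> 'i::countable \<Rightarrow> real"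
  assumes "\<And>i. i \<in> insert a (set xs) \<Longrightarrow> (\<lambda>\<omega>. f \<omega> i) \<in> borel_measurable M"
  shows "(\<lambda>\<omega>. insort_key (f \<omega>) a xs) \<in> measurable M (count_space UNIV)"
  using assms
proof (induction xs)
  case (Cons b xs)
  have [measurable]: "(\<lambda>\<omega>. f \<omega> a) \<in> borel_measurable M" "(\<lambda>\<omega>. f \<omega> b) \<in> borel_measurable M"
    "(\<lambda>\<omega>. insort_key (f \<omega>) a xs) \<in> measurable M (count_space UNIV)"
    using Cons by auto
  show ?case
    by simp
qed simp

text \<open>
  A sorted list takes countably many values, so the recursive call can be replaced by a constant list.
  This list is restricted to elements of \<open>xs\<close>, as only their keys are known to be measurable;
  the restriction is vacuous for the list that actually occurs.
\<close>

lemma measurable_sort_key: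
  fixes f :: "'w \<Rightarrow> 'i::countable \<Rightarrow> real"
  assumes "\<And>i. i \<in> set xs \<Longrightarrow> (\<lambda>\<omega>. f \<omega> i) \<in> borel_measurable M"
  shows "(\<lambda>\<omega>. sort_key (f \<omega>) xs) \<in> measurable M (count_space UNIV)"
  using assms
proof (induction xs)
  case (Cons a xs)
  have "(\<lambda>\<omega>. insort_key (f \<omega>) a (if set (sort_key (f \<omega>) xs) \<subseteq> set xs then sort_key (f \<omega>) xs else []))
          \<in> measurable M (count_space UNIV)"
  proof (rule measurable_compose_countable[where g = "\<lambda>\<omega>. sort_key (f \<omega>) xs"
        and f = "\<lambda>l \<omega>. insort_key (f \<omega>) a (if set l \<subseteq> set xs then l else [])"])
    show "(\<lambda>\<omega>. insort_key (f \<omega>) a (if set l \<subseteq> set xs then l else [])) \<in> measurable M (count_space UNIV)" for l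
      using Cons.prems by (intro measurable_insort_key) (auto split: if_splits)
  qed (use Cons in auto)
  then show ?case
    by simp
qed simp

lemma measurable_nn_index:
  fixes N :: "'a::euclidean_space \<Rightarrow> real"
  assumes N: "is_norm N" and u: "\<And>i. i < n \<Longrightarrow> (\<lambda>\<omega>. u \<omega> i) \<in> borel_measurable M"
  shows "(\<lambda>\<omega>. nn_index N n (u \<omega>) x j) \<in> measurable M (count_space UNIV)"
proof -
  have [measurable]: "N \<in> borel_measurable borel"
    by (intro borel_measurable_continuous_onI continuous_on_is_norm N)
  have "(\<lambda>\<omega>. sort_key (\<lambda>i. N (x - u \<omega> i)) [0..<n]) \<in> measurable M (count_space UNIV)"
  proof (rule measurable_sort_key)
    fix i assume "i \<in> set [0..<n]"
    then have [measurable]: "(\<lambda>\<omega>. u \<omega> i) \<in> borel_measurable M"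
      using u by simp
    show "(\<lambda>\<omega>. N (x - u \<omega> i)) \<in> borel_measurable M"
      by measurable
  qed
  then show ?thesis
    unfolding nn_index_def by measurable
qed

lemma pred_neighbours:
  fixes N :: "'a::euclidean_space \<Rightarrow> real"
  assumes "is_norm N" and "\<And>i. i < n \<Longrightarrow> (\<lambda>\<omega>. u \<omega> i) \<in> borel_measurable M"
  shows "Measurable.pred M (\<lambda>\<omega>. i \<in> neighbours N n k x (u \<omega>))"
proof -
  have [measurable]: "(\<lambda>\<omega>. nn_index N n (u \<omega>) x j) \<in> measurable M (count_space UNIV)" for j
    using assms by (rule measurable_nn_index)
  have "Measurable.pred M (\<lambda>\<omega>. \<exists>j\<in>{..<k}. i = nn_index N n (u \<omega>) x j)"
    by measurable
  then show ?thesis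
    by (simp add: neighbours_def image_iff)
qed

text \<open>
  A finite list of countably valued variables is again countably valued: this lets the retrieved labels
  be treated as a single discrete random variable.
\<close>

lemma measurable_map_list:
  fixes f :: "'b \<Rightarrow> 'w \<Rightarrow> 'i::countable"
  assumes "\<And>j. j \<in> set xs \<Longrightarrow> f j \<in> measurable M (count_space UNIV)"
  shows "(\<lambda>\<omega>. map (\<lambda>j. f j \<omega>) xs) \<in> measurable M (count_space UNIV)"
  using assms
proof (induction xs)
  case (Cons a xs)
  have [measurable]: "f a \<in> measurable M (count_space UNIV)"
    "(\<lambda>\<omega>. map (\<lambda>j. f j \<omega>) xs) \<in> measurable M (count_space UNIV)"
    using Cons by auto
  show ?case
    by simp
qed simp

lemma neighbours_cong:
  assumes "\<And>i. i < n \<Longrightarrow> u i = u' i"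
  shows "neighbours N n k x u = neighbours N n k x u'"
proof -
  have "nn_index N n u x = nn_index N n u' x"
    by (rule nn_index_cong) (rule assms)
  then show ?thesis
    by (simp add: neighbours_def)
qed

text \<open>
  The frequencies are a function of the discrete list of retrieved labels. For a fixed list the modal label
  and the cross-entropies are constants, and only the trust weight remains random.
\<close>

lemma measurable_gated_gain:
  fixes N :: "'a::euclidean_space \<Rightarrow> real"
  assumes N: "is_norm N"
    and U[measurable]: "\<And>i. U i \<in> borel_measurable M"
    and V[measurable]: "\<And>i. V i \<in> measurable M (count_space UNIV)"
  shows "(\<lambda>\<omega>. gated_gain C sel \<zeta> p q (retriever N n k (\<lambda>i. U i \<omega>) (\<lambda>i. V i \<omega>) x)
                 (trust_weight N n k (\<lambda>i. U i \<omega>) x)) \<in> borel_measurable M"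
proof -
  have [measurable]: "N \<in> borel_measurable borel"
    by (intro borel_measurable_continuous_onI continuous_on_is_norm N)
  have nn[measurable]: "(\<lambda>\<omega>. nn_index N n (\<lambda>i. U i \<omega>) x j) \<in> measurable M (count_space UNIV)" for j
    by (intro measurable_nn_index N U)
  have "(\<lambda>\<omega>. N (x - U (nn_index N n (\<lambda>i. U i \<omega>) x j) \<omega>)) \<in> borel_measurable M" for j
    by (rule measurable_compose_countable[OF _ nn]) measurable
  then have w[measurable]: "(\<lambda>\<omega>. trust_weight N n k (\<lambda>i. U i \<omega>) x) \<in> borel_measurable M"
    unfolding trust_weight_def by measurable
  define labels where "labels \<omega> = map (\<lambda>j. V (nn_index N n (\<lambda>i. U i \<omega>) x j) \<omega>) [0..<k]" for \<omega>
  have labels: "labels \<in> measurable M (count_space UNIV)"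
    unfolding labels_def[abs_def] by (rule measurable_map_list) (rule measurable_compose_countable[OF V nn])
  define freq where "freq l y = (\<Sum>j<k. of_bool (l ! j = y)) / real k" for l :: "nat list" and y
  have freq: "retriever N n k (\<lambda>i. U i \<omega>) (\<lambda>i. V i \<omega>) x = freq (labels \<omega>)" for \<omega>
    unfolding retriever_def freq_def labels_def by (intro ext arg_cong2[where f = "(/)"] sum.cong refl) simp
  show ?thesis
    unfolding freq
  proof (rule measurable_compose_countable[OF _ labels])
    fix l
    have "(\<lambda>\<omega>. of_bool (a + ereal (\<zeta> * (1 - W \<omega>)) < b) * W \<omega> * d) \<in> borel_measurable M"
      if [measurable]: "W \<in> borel_measurable M" for a b :: ereal and d :: real and W
    proof -
      have "{\<omega> \<in> space M. a + ereal (\<zeta> * (1 - W \<omega>)) < b} \<in> sets M"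
        by measurable
      then have "(\<lambda>\<omega>. if a + ereal (\<zeta> * (1 - W \<omega>)) < b then 1 else 0 :: real) \<in> borel_measurable M"
        by (intro measurable_If) auto
      then show ?thesis
        unfolding of_bool_def by (intro borel_measurable_times that) auto
    qed
    from this[OF w] show "(\<lambda>\<omega>. gated_gain C sel \<zeta> p q (freq l) (trust_weight N n k (\<lambda>i. U i \<omega>) x)) \<in> borel_measurable M"
      unfolding gated_gain_def Let_def .
  qed
qed

section \<open>Sums of centred marks over a position-dependent selection\<close>

text \<open>
  The marks \<open>\<xi> (U i, V i)\<close> are centred given \<open>U i\<close>, and the selection \<open>S\<close> looks at the positions
  \<open>U\<close> only. Hence distinct selected marks are orthogonal: fixing everything except the pair with index
  \<open>i\<close>, the event that both \<open>i\<close> and \<open>j\<close> are selected is an event \<open>D\<close> on \<open>U i\<close>, over which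
  \<open>\<xi> (U i, V i)\<close> integrates to \<open>0\<close>. Only the diagonal survives in the square of the sum, and it
  contributes at most the number of selected indices. This avoids conditioning on all positions at once.
\<close>

lemma (in prob_space) selected_sum_second_moment:
  fixes U :: "nat \<Rightarrow> 'a \<Rightarrow> 'b" and V :: "nat \<Rightarrow> 'a \<Rightarrow> 'c" and \<xi> :: "'b \<times> 'c \<Rightarrow> real"
    and S :: "(nat \<Rightarrow> 'b) \<Rightarrow> nat set"
  assumes indep: "indep_vars (\<lambda>_. A \<Otimes>\<^sub>M B) (\<lambda>i \<omega>. (U i \<omega>, V i \<omega>)) {..<n}"
    and \<xi>[measurable]: "\<xi> \<in> borel_measurable (A \<Otimes>\<^sub>M B)"
    and bound: "\<And>a. \<bar>\<xi> a\<bar> \<le> 1"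
    and centred: "\<And>i D. i < n \<Longrightarrow> D \<in> sets A \<Longrightarrow>
      expectation (\<lambda>\<omega>. indicator D (U i \<omega>) * \<xi> (U i \<omega>, V i \<omega>)) = 0"
    and sub: "\<And>u. S u \<subseteq> {..<n}" and card: "\<And>u. card (S u) \<le> k"
    and meas_S[measurable]: "\<And>i. Measurable.pred (PiM {..<n} (\<lambda>_. A)) (\<lambda>u. i \<in> S u)"
  shows "expectation (\<lambda>\<omega>. (\<Sum>i\<in>S (\<lambda>i\<in>{..<n}. U i \<omega>). \<xi> (U i \<omega>, V i \<omega>))\<^sup>2) \<le> real k"
proof (cases "n = 0")
  case True
  then show ?thesis
    using sub by simp
next
  case False
  let ?I = "{..<n}"
  define Q where "Q i = distr M (A \<Otimes>\<^sub>M B) (\<lambda>\<omega>. (U i \<omega>, V i \<omega>))" for i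
  have UV[measurable]: "(\<lambda>\<omega>. (U i \<omega>, V i \<omega>)) \<in> measurable M (A \<Otimes>\<^sub>M B)" if "i \<in> ?I" for i
    using indep that by (auto simp: indep_vars_def)
  have sets_Q[measurable_cong]: "sets (Q i) = sets (A \<Otimes>\<^sub>M B)" for i
    by (simp add: Q_def)
  \<comment> \<open>Indices outside \<open>?I\<close> are redirected to \<open>0\<close> so that every factor is a probability space.\<close>
  define Q' where "Q' i = Q (if i < n then i else 0)" for i
  have sets_Q'[measurable_cong]: "sets (Q' i) = sets (A \<Otimes>\<^sub>M B)" for i
    by (simp add: Q'_def sets_Q)
  interpret Q': prob_space "Q' i" for i
    unfolding Q'_def Q_def using False by (intro prob_space_distr UV) auto
  interpret PQ: product_prob_space Q' ?I ..
  define T where "T \<omega> = (\<lambda>i\<in>?I. (U i \<omega>, V i \<omega>))" for \<omega>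
  have T[measurable]: "T \<in> measurable M (PiM ?I (\<lambda>_. A \<Otimes>\<^sub>M B))"
    unfolding T_def by (intro measurable_restrict UV)
  have nonempty: "?I \<noteq> {}"
    using False by auto
  have "distr M (PiM ?I (\<lambda>_. A \<Otimes>\<^sub>M B)) T = PiM ?I Q"
    using indep_vars_iff_distr_eq_PiM'[where I = ?I and M' = "\<lambda>_. A \<Otimes>\<^sub>M B"
        and X = "\<lambda>i \<omega>. (U i \<omega>, V i \<omega>)"] nonempty indep UV
    unfolding T_def Q_def by blast
  also have "PiM ?I Q = PiM ?I Q'"
    by (intro PiM_cong) (auto simp: Q'_def)
  finally have distr_T: "distr M (PiM ?I (\<lambda>_. A \<Otimes>\<^sub>M B)) T = PiM ?I Q'" .
  have sets_PQ: "sets (PiM ?I Q') = sets (PiM ?I (\<lambda>_. A \<Otimes>\<^sub>M B))"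
    by (intro sets_PiM_cong sets_Q' refl)
  define S' where "S' z = S (\<lambda>i\<in>?I. fst (z i))" for z :: "nat \<Rightarrow> 'b \<times> 'c"
  have S'_sub: "S' z \<subseteq> ?I" for z
    using sub by (simp add: S'_def)
  have [measurable]: "Measurable.pred (PiM ?I Q') (\<lambda>z. i \<in> S' z)" for i
    unfolding S'_def by measurable
  define f where "f i j z = of_bool (i \<in> S' z \<and> j \<in> S' z) * (\<xi> (z i) * \<xi> (z j))" for i j z
  have f_meas[measurable]: "f i j \<in> borel_measurable (PiM ?I Q')" if "i \<in> ?I" "j \<in> ?I" for i j
    unfolding f_def using that by measurable
  have xi2: "\<bar>\<xi> a * \<xi> b\<bar> \<le> 1" for a b
    using mult_mono[OF bound bound] by (simp add: abs_mult)
  have f_int: "integrable (PiM ?I Q') (f i j)" if "i \<in> ?I" "j \<in> ?I" for i j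
    by (rule PQ.P.integrable_const_bound[where B = 1])
      (use xi2 f_meas[OF that] in \<open>auto simp: f_def\<close>)
  \<comment> \<open>Fubini: integrate the pair with index \<open>i\<close> first, all the others being fixed in \<open>z\<close>.\<close>
  have off: "integral\<^sup>L (PiM ?I Q') (f i j) = 0" if ij: "i \<in> ?I" "j \<in> ?I" "i \<noteq> j" for i j
  proof -
    let ?J = "?I - {i}"
    have I: "?I = insert i ?J"
      using ij by auto
    have "integral\<^sup>L (PiM ?I Q') (f i j) = (\<integral>z. (\<integral>a. f i j (z(i := a)) \<partial>Q' i) \<partial>PiM ?J Q')"
      using PQ.product_integral_insert[of ?J i "f i j"] f_int[OF ij(1,2)] I by simp
    also have "\<dots> = (\<integral>z. 0 \<partial>PiM ?J Q')"
    proof (rule Bochner_Integration.integral_cong[OF refl])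
      fix z assume z: "z \<in> space (PiM ?J Q')"
      define D where "D = {b \<in> space A. i \<in> S ((\<lambda>l\<in>?I. fst (z l))(i := b)) \<and> j \<in> S ((\<lambda>l\<in>?I. fst (z l))(i := b))}"
      have space_Q': "space (Q' l) = space A \<times> space B" for l
        using sets_eq_imp_space_eq[OF sets_Q'[of l]] by (simp add: space_pair_measure)
      have "z l \<in> space A \<times> space B" if "l \<in> ?J" for l
        using z that unfolding space_PiM space_Q' by (rule PiE_mem)
      then have "fst (z l) \<in> space A" if "l \<in> ?J" for l
        using that by (metis mem_Times_iff)
      then have z_fst: "(\<lambda>l\<in>?J. fst (z l)) \<in> space (PiM ?J (\<lambda>_. A))"
        unfolding space_PiM by (intro restrict_PiE_iff[THEN iffD2] ballI)
      have upd: "(\<lambda>b. (\<lambda>l\<in>?J. fst (z l))(i := b)) \<in> measurable A (PiM (insert i ?J) (\<lambda>_. A))"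
        using z_fst by (intro measurable_fun_upd[where J = ?J]) auto
      have upd_eq: "(\<lambda>l\<in>?J. fst (z l))(i := b) = (\<lambda>l\<in>?I. fst (z l))(i := b)" for b
        using ij by (auto simp: fun_eq_iff)
      have [measurable]: "(\<lambda>b. (\<lambda>l\<in>?I. fst (z l))(i := b)) \<in> measurable A (PiM ?I (\<lambda>_. A))"
        using upd unfolding upd_eq I[symmetric] .
      have D: "D \<in> sets A"
        unfolding D_def by measurable
      have fst_upd: "(\<lambda>l\<in>?I. fst ((z(i := a)) l)) = (\<lambda>l\<in>?I. fst (z l))(i := fst a)" for a
        using ij by (auto simp: fun_eq_iff)
      have S'_upd: "S' (z(i := a)) = S ((\<lambda>l\<in>?I. fst (z l))(i := fst a))" for a
        unfolding S'_def fst_upd ..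
      have "f i j (z(i := a)) = \<xi> (z j) * (indicator D (fst a) * \<xi> a)" if "a \<in> space (Q' i)" for a
      proof -
        have "fst a \<in> space A"
          using that by (auto simp: space_Q')
        then have "i \<in> S' (z(i := a)) \<and> j \<in> S' (z(i := a)) \<longleftrightarrow> fst a \<in> D"
          by (simp add: S'_upd D_def)
        then show ?thesis
          using ij(3) by (simp add: f_def indicator_def)
      qed
      then have "(\<integral>a. f i j (z(i := a)) \<partial>Q' i) = (\<integral>a. \<xi> (z j) * (indicator D (fst a) * \<xi> a) \<partial>Q' i)"
        by (intro Bochner_Integration.integral_cong refl)
      also have "\<dots> = \<xi> (z j) * (\<integral>a. indicator D (fst a) * \<xi> a \<partial>Q' i)"
        by simp
      also have "(\<integral>a. indicator D (fst a) * \<xi> a \<partial>Q' i)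
          = expectation (\<lambda>\<omega>. indicator D (U i \<omega>) * \<xi> (U i \<omega>, V i \<omega>))"
        using ij D UV[OF ij(1)] unfolding Q'_def Q_def by (simp add: integral_distr)
      also have "\<dots> = 0"
        using ij D by (intro centred) auto
      finally show "(\<integral>a. f i j (z(i := a)) \<partial>Q' i) = 0"
        by (simp only: mult_zero_right)
    qed
    finally show ?thesis
      by simp
  qed
  have diag: "integral\<^sup>L (PiM ?I Q') (f i i) \<le> (\<integral>z. of_bool (i \<in> S' z) \<partial>PiM ?I Q')" if i: "i \<in> ?I" for i
  proof (rule integral_mono[OF f_int[OF i i]])
    show "integrable (PiM ?I Q') (\<lambda>z. of_bool (i \<in> S' z) :: real)"
      by (rule PQ.P.integrable_const_bound[where B = 1]) auto
    show "f i i z \<le> of_bool (i \<in> S' z)" for z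
      using xi2[of "z i" "z i"] by (auto simp: f_def)
  qed
  have expand: "(\<Sum>i\<in>S' z. \<xi> (z i))\<^sup>2 = (\<Sum>i<n. \<Sum>j<n. f i j z)" for z
  proof -
    have eq: "(\<Sum>i\<in>S' z. \<xi> (z i)) = (\<Sum>i<n. of_bool (i \<in> S' z) * \<xi> (z i))"
      using S'_sub by (intro sum.mono_neutral_cong_left) auto
    show ?thesis
      unfolding eq power2_eq_square by (simp only: sum_product f_def of_bool_conj mult_ac)
  qed
  have "expectation (\<lambda>\<omega>. (\<Sum>i\<in>S (\<lambda>i\<in>?I. U i \<omega>). \<xi> (U i \<omega>, V i \<omega>))\<^sup>2)
      = expectation (\<lambda>\<omega>. (\<Sum>i\<in>S' (T \<omega>). \<xi> (T \<omega> i))\<^sup>2)"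
    using sub unfolding S'_def T_def
    by (intro Bochner_Integration.integral_cong refl arg_cong[where f = "\<lambda>t. t\<^sup>2"] sum.cong
        arg_cong[where f = S]) (auto simp: fun_eq_iff)
  also have "\<dots> = expectation (\<lambda>\<omega>. \<Sum>i<n. \<Sum>j<n. f i j (T \<omega>))"
    by (simp add: expand)
  also have "\<dots> = (\<integral>z. (\<Sum>i<n. \<Sum>j<n. f i j z) \<partial>PiM ?I Q')"
    unfolding distr_T[symmetric]
    by (rule integral_distr[symmetric, OF T])
      (use f_meas in \<open>auto intro!: borel_measurable_sum simp: measurable_cong_sets[OF sets_PQ refl]\<close>)
  also have "\<dots> = (\<Sum>i<n. \<Sum>j<n. integral\<^sup>L (PiM ?I Q') (f i j))"
    using f_int
    by (subst Bochner_Integration.integral_sum; intro Bochner_Integration.integrable_sum sum.cong refl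
        Bochner_Integration.integral_sum) auto
  also have "\<dots> = (\<Sum>i<n. integral\<^sup>L (PiM ?I Q') (f i i))"
  proof (rule sum.cong[OF refl])
    fix i assume i: "i \<in> ?I"
    have "(\<Sum>j<n. integral\<^sup>L (PiM ?I Q') (f i j)) = (\<Sum>j<n. if j = i then integral\<^sup>L (PiM ?I Q') (f i i) else 0)"
      using off i by (intro sum.cong) auto
    then show "(\<Sum>j<n. integral\<^sup>L (PiM ?I Q') (f i j)) = integral\<^sup>L (PiM ?I Q') (f i i)"
      using i by simp
  qed
  also have "\<dots> \<le> (\<Sum>i<n. \<integral>z. of_bool (i \<in> S' z) \<partial>PiM ?I Q')"
    by (intro sum_mono diag)
  also have "\<dots> = (\<integral>z. (\<Sum>i<n. of_bool (i \<in> S' z)) \<partial>PiM ?I Q')"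
    by (rule Bochner_Integration.integral_sum[symmetric])
      (rule PQ.P.integrable_const_bound[where B = 1], auto)
  also have "\<dots> \<le> (\<integral>z. real k \<partial>PiM ?I Q')"
  proof (rule integral_mono)
    show "integrable (PiM ?I Q') (\<lambda>z. \<Sum>i<n. of_bool (i \<in> S' z) :: real)"
      by (intro Bochner_Integration.integrable_sum PQ.P.integrable_const_bound[where B = 1]) auto
    have "(\<Sum>i<n. of_bool (i \<in> S' z)) = real (card (S' z))" for z
      using S'_sub[of z] by (simp add: sum_of_bool_eq Int_absorb1 Int_def[symmetric])
    then show "(\<Sum>i<n. of_bool (i \<in> S' z)) \<le> real k" for z
      using card by (simp add: S'_def)
  qed auto
  also have "\<dots> = real k"
    by (simp add: PQ.P.prob_space)
  finally show ?thesis .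
qed

section \<open>Concentration of the retrieved labels\<close>

lemma label_dist_le_one:
  assumes "label_dist C q" "y \<in> {1..C}"
  shows "0 \<le> q y" "q y \<le> 1"
proof -
  show "0 \<le> q y"
    using assms by (auto simp: label_dist_def)
  have "q y \<le> (\<Sum>y=1..C. q y)"
    using assms by (intro member_le_sum) (auto simp: label_dist_def)
  then show "q y \<le> 1"
    using assms by (simp add: label_dist_def)
qed

lemma average_close:
  fixes f :: "nat \<Rightarrow> real"
  assumes "0 < k" "\<And>j. j < k \<Longrightarrow> \<bar>f j - c\<bar> \<le> e"
  shows "\<bar>(\<Sum>j<k. f j) / real k - c\<bar> \<le> e"
proof -
  have "(\<Sum>j<k. f j) / real k - c = (\<Sum>j<k. f j - c) / real k"
    using assms(1) by (simp add: sum_subtractf diff_divide_distrib)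
  also have "\<bar>\<dots>\<bar> \<le> (\<Sum>j<k. \<bar>f j - c\<bar>) / real k"
    by (simp add: divide_right_mono)
  also have "\<dots> \<le> (\<Sum>j<k. e) / real k"
    using assms(2) by (intro divide_right_mono sum_mono) auto
  also have "\<dots> = e"
    using assms(1) by simp
  finally show ?thesis .
qed

text \<open>
  This is the defining property of a conditional distribution, in the form required of the marks in
  \<open>selected_sum_second_moment\<close>.
\<close>

lemma (in prob_space) cond_dist_centred:
  fixes U :: "'a \<Rightarrow> 'b::topological_space"
  assumes U[measurable]: "U \<in> borel_measurable M" and V[measurable]: "V \<in> measurable M (count_space {1..C})"
    and p: "is_cond_dist M U V C p" and y: "y \<in> {1..C}" and D[measurable]: "D \<in> sets borel"
  shows "expectation (\<lambda>\<omega>. indicator D (U \<omega>) * (of_bool (V \<omega> = y) - p (U \<omega>) y)) = 0"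
proof -
  have py[measurable]: "(\<lambda>u. p u y) \<in> borel_measurable borel"
    using p y by (auto simp: is_cond_dist_def)
  have p01: "0 \<le> p u y" "p u y \<le> 1" for u
    using p y label_dist_le_one[of C "p u" y] by (auto simp: is_cond_dist_def)
  have VU[measurable]: "V \<in> measurable M (count_space UNIV)"
    by (rule measurable_compose[OF V]) simp
  have ev[measurable]: "{\<omega> \<in> space M. U \<omega> \<in> D \<and> V \<omega> = y} \<in> events"
    by measurable
  have "expectation (\<lambda>\<omega>. indicator D (U \<omega>) * of_bool (V \<omega> = y) :: real)
      = expectation (indicator {\<omega> \<in> space M. U \<omega> \<in> D \<and> V \<omega> = y})"
    by (intro Bochner_Integration.integral_cong) (auto simp: indicator_def)
  also have "\<dots> = prob {\<omega> \<in> space M. U \<omega> \<in> D \<and> V \<omega> = y}"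
    using ev by simp
  also have "\<dots> = (LINT u:D|distr M borel U. p u y)"
    using p y D by (auto simp: is_cond_dist_def)
  also have "\<dots> = expectation (\<lambda>\<omega>. indicator D (U \<omega>) * p (U \<omega>) y)"
    unfolding set_lebesgue_integral_def by (subst integral_distr) auto
  finally have eq: "expectation (\<lambda>\<omega>. indicator D (U \<omega>) * of_bool (V \<omega> = y))
      = expectation (\<lambda>\<omega>. indicator D (U \<omega>) * p (U \<omega>) y)" .
  have "integrable M (\<lambda>\<omega>. indicator D (U \<omega>) * of_bool (V \<omega> = y) :: real)"
    by (rule integrable_const_bound[where B = 1]) (auto simp: indicator_def)
  moreover have "integrable M (\<lambda>\<omega>. indicator D (U \<omega>) * p (U \<omega>) y)"
    by (rule integrable_const_bound[where B = 1]) (use p01 in \<open>auto simp: indicator_def\<close>)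
  ultimately show ?thesis
    by (simp add: right_diff_distrib eq)
qed

text \<open>
  Whether \<open>p\<close> is a conditional distribution depends on the joint law only, so all pairs of the memory share
  the conditional distribution of the first one.
\<close>

lemma is_cond_dist_cong_joint:
  fixes U U' :: "'w \<Rightarrow> 'b::topological_space"
  assumes p: "is_cond_dist M U V C p"
    and joint: "distr M (borel \<Otimes>\<^sub>M count_space {1..C}) (\<lambda>\<omega>. (U' \<omega>, V' \<omega>))
              = distr M (borel \<Otimes>\<^sub>M count_space {1..C}) (\<lambda>\<omega>. (U \<omega>, V \<omega>))"
    and UV: "(\<lambda>\<omega>. (U \<omega>, V \<omega>)) \<in> measurable M (borel \<Otimes>\<^sub>M count_space {1..C})"
    and UV': "(\<lambda>\<omega>. (U' \<omega>, V' \<omega>)) \<in> measurable M (borel \<Otimes>\<^sub>M count_space {1..C})"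
  shows "is_cond_dist M U' V' C p"
proof -
  let ?W = "borel \<Otimes>\<^sub>M count_space {1..C}"
  have marg: "distr M borel u = distr (distr M ?W (\<lambda>\<omega>. (u \<omega>, v \<omega>))) borel fst"
    if "(\<lambda>\<omega>. (u \<omega>, v \<omega>)) \<in> measurable M ?W" for u :: "'w \<Rightarrow> 'b" and v
    using distr_distr[OF measurable_fst that] by (simp add: o_def)
  have law: "measure M {\<omega> \<in> space M. u \<omega> \<in> A \<and> v \<omega> = y} = measure (distr M ?W (\<lambda>\<omega>. (u \<omega>, v \<omega>))) (A \<times> {y})"
    if uv: "(\<lambda>\<omega>. (u \<omega>, v \<omega>)) \<in> measurable M ?W" and A: "A \<in> sets borel" "y \<in> {1..C}"
    for u :: "'w \<Rightarrow> 'b" and v A y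
  proof -
    have "A \<times> {y} \<in> sets ?W"
      using A by (intro pair_measureI) auto
    then have "measure (distr M ?W (\<lambda>\<omega>. (u \<omega>, v \<omega>))) (A \<times> {y})
        = measure M ((\<lambda>\<omega>. (u \<omega>, v \<omega>)) -` (A \<times> {y}) \<inter> space M)"
      by (rule measure_distr[OF uv])
    also have "(\<lambda>\<omega>. (u \<omega>, v \<omega>)) -` (A \<times> {y}) \<inter> space M = {\<omega> \<in> space M. u \<omega> \<in> A \<and> v \<omega> = y}"
      by auto
    finally show ?thesis ..
  qed
  have "distr M borel U' = distr M borel U"
    using marg[OF UV] marg[OF UV'] joint by simp
  moreover have "measure M {\<omega> \<in> space M. U' \<omega> \<in> A \<and> V' \<omega> = y} = measure M {\<omega> \<in> space M. U \<omega> \<in> A \<and> V \<omega> = y}"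
    if "A \<in> sets borel" "y \<in> {1..C}" for A y
    using law[OF UV that] law[OF UV' that] joint by simp
  ultimately show ?thesis
    using p unfolding is_cond_dist_def by (auto simp del: Collect_conj_eq)
qed

text \<open>
  Instance of \<open>selected_sum_second_moment\<close> in which the nearest neighbours are the selected indices: the
  frequency of \<open>y\<close> among the retrieved labels is compared with the average of \<open>p(y | U)\<close> over the
  positions that were retrieved, and the variance is at most \<open>1 / k\<close>.
\<close>

lemma (in prob_space) retriever_concentration:
  fixes N :: "'b::euclidean_space \<Rightarrow> real" and U :: "nat \<Rightarrow> 'a \<Rightarrow> 'b" and x :: 'b
  assumes N: "is_norm N"
    and indep: "indep_vars (\<lambda>_. borel \<Otimes>\<^sub>M count_space {1..C}) (\<lambda>i \<omega>. (U i \<omega>, V i \<omega>)) UNIV"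
    and p: "\<And>i. is_cond_dist M (U i) (V i) C p"
    and y: "y \<in> {1..C}" and k: "0 < k" "k \<le> n" and e: "0 < e"
  defines "R \<equiv> \<lambda>\<omega>. retriever N n k (\<lambda>i. U i \<omega>) (\<lambda>i. V i \<omega>) x y
            - (\<Sum>j<k. p (U (nn_index N n (\<lambda>i. U i \<omega>) x j) \<omega>) y) / real k"
  shows "R \<in> borel_measurable M"
    and "prob {\<omega> \<in> space M. e \<le> \<bar>R \<omega>\<bar>} \<le> 1 / (real k * e\<^sup>2)"
proof -
  let ?W = "borel \<Otimes>\<^sub>M count_space {1..C}"
  have UV[measurable]: "(\<lambda>\<omega>. (U i \<omega>, V i \<omega>)) \<in> measurable M ?W" for i
    using indep by (auto simp: indep_vars_def)
  have U[measurable]: "U i \<in> borel_measurable M" for i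
    using measurable_compose[OF UV measurable_fst] by simp
  have V[measurable]: "V i \<in> measurable M (count_space {1..C})" for i
    using measurable_compose[OF UV measurable_snd] by simp
  have py[measurable]: "(\<lambda>u. p u y) \<in> borel_measurable borel"
    using p[of 0] y by (auto simp: is_cond_dist_def)
  have p01: "0 \<le> p u y" "p u y \<le> 1" for u
    using p[of 0] y label_dist_le_one[of C "p u" y] by (auto simp: is_cond_dist_def)
  define \<xi> where "\<xi> a = of_bool (snd a = y) - p (fst a) y" for a :: "'b \<times> nat"
  have snd[measurable]: "(\<lambda>a. snd a) \<in> measurable ?W (count_space UNIV)"
    by (rule measurable_compose[OF measurable_snd]) simp
  have \<xi>[measurable]: "\<xi> \<in> borel_measurable ?W"
    unfolding \<xi>_def of_bool_def by measurable
  have bound: "\<bar>\<xi> a\<bar> \<le> 1" for a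
    using p01 by (simp add: \<xi>_def)
  have nn[measurable]: "(\<lambda>\<omega>. nn_index N n (\<lambda>i. U i \<omega>) x j) \<in> measurable M (count_space UNIV)" for j
    by (intro measurable_nn_index N U)
  have R_eq: "R \<omega> = (\<Sum>j<k. \<xi> (U (nn_index N n (\<lambda>i. U i \<omega>) x j) \<omega>, V (nn_index N n (\<lambda>i. U i \<omega>) x j) \<omega>)) / real k" for \<omega>
    by (simp add: R_def retriever_def \<xi>_def sum_subtractf diff_divide_distrib)
  have "(\<lambda>\<omega>. \<xi> (U (nn_index N n (\<lambda>i. U i \<omega>) x j) \<omega>, V (nn_index N n (\<lambda>i. U i \<omega>) x j) \<omega>)) \<in> borel_measurable M" for j
    by (rule measurable_compose_countable[OF _ nn]) measurable
  then show R[measurable]: "R \<in> borel_measurable M"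
    unfolding R_eq[abs_def] by measurable
  have R_eq': "R \<omega> = (\<Sum>i\<in>neighbours N n k x (\<lambda>i\<in>{..<n}. U i \<omega>). \<xi> (U i \<omega>, V i \<omega>)) / real k" for \<omega>
  proof -
    have "neighbours N n k x (\<lambda>i\<in>{..<n}. U i \<omega>) = neighbours N n k x (\<lambda>i. U i \<omega>)"
      by (rule neighbours_cong) simp
    then show ?thesis
      unfolding R_eq by (simp only: sum_neighbours[OF k(2), where h = "\<lambda>i. \<xi> (U i \<omega>, V i \<omega>)"])
  qed
  have "expectation (\<lambda>\<omega>. (\<Sum>i\<in>neighbours N n k x (\<lambda>i\<in>{..<n}. U i \<omega>). \<xi> (U i \<omega>, V i \<omega>))\<^sup>2) \<le> real k"
  proof (rule selected_sum_second_moment[OF _ \<xi> bound])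
    show "indep_vars (\<lambda>_. ?W) (\<lambda>i \<omega>. (U i \<omega>, V i \<omega>)) {..<n}"
      using indep by (rule indep_vars_subset) simp
    show "expectation (\<lambda>\<omega>. indicator D (U i \<omega>) * \<xi> (U i \<omega>, V i \<omega>)) = 0" if "D \<in> sets borel" for i D
      using cond_dist_centred[OF U V p y that] by (simp add: \<xi>_def)
    show "Measurable.pred (PiM {..<n} (\<lambda>_. borel)) (\<lambda>u. i \<in> neighbours N n k x u)" for i
      by (rule pred_neighbours[OF N]) (simp add: measurable_component_singleton)
  qed (simp_all add: neighbours_subset card_neighbours k(2))
  then have second: "expectation (\<lambda>\<omega>. (R \<omega>)\<^sup>2) \<le> 1 / real k"
    unfolding R_eq' using k(1) by (simp add: power_divide power2_eq_square field_simps)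
  have R_bound: "\<bar>R \<omega>\<bar> \<le> 1" for \<omega>
    using average_close[of k "\<lambda>j. \<xi> (U (nn_index N n (\<lambda>i. U i \<omega>) x j) \<omega>, V (nn_index N n (\<lambda>i. U i \<omega>) x j) \<omega>)" 0 1] k bound
    unfolding R_eq by simp
  have "integrable M (\<lambda>\<omega>. (R \<omega>)\<^sup>2)"
    using R_bound by (intro integrable_const_bound[where B = 1]) (auto simp: abs_square_le_1)
  then have "prob {\<omega> \<in> space M. e \<le> \<bar>R \<omega>\<bar>} \<le> expectation (\<lambda>\<omega>. (R \<omega>)\<^sup>2) / e\<^sup>2"
    using e R by (intro second_moment_method) auto
  also have "\<dots> \<le> (1 / real k) / e\<^sup>2"
    by (intro divide_right_mono second) simp
  finally show "prob {\<omega> \<in> space M. e \<le> \<bar>R \<omega>\<bar>} \<le> 1 / (real k * e\<^sup>2)"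
    by simp
qed

section \<open>Number of memory points in a ball\<close>

text \<open>
  The number of hits has mean \<open>n * \<pi>\<close>, while \<open>k n\<close> is eventually below half of this; by Hoeffding's
  inequality such a deviation has exponentially small probability.
\<close>

lemma (in prob_space) few_hits_prob_tendsto_0:
  fixes U :: "nat \<Rightarrow> 'a \<Rightarrow> 'b"
  assumes indep: "indep_vars (\<lambda>_. A) U UNIV" and B[measurable]: "B \<in> sets A"
    and hit: "\<And>i. prob {\<omega> \<in> space M. U i \<omega> \<in> B} = \<pi>" and \<pi>: "0 < \<pi>"
    and k: "(\<lambda>n. real (k n) / real n) \<longlonglongrightarrow> 0"
  shows "(\<lambda>n. prob {\<omega> \<in> space M. (\<Sum>i<n. indicator B (U i \<omega>)) < real (k n)}) \<longlonglongrightarrow> 0"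
proof (rule tendsto_sandwich[OF _ _ tendsto_const])
  have U[measurable]: "U i \<in> measurable M A" for i
    using indep by (auto simp: indep_vars_def)
  have mean: "expectation (\<lambda>\<omega>. indicator B (U i \<omega>)) = \<pi>" for i
  proof -
    have "expectation (\<lambda>\<omega>. indicator B (U i \<omega>) :: real) = expectation (indicator {\<omega> \<in> space M. U i \<omega> \<in> B})"
      by (intro Bochner_Integration.integral_cong) (auto simp: indicator_def)
    then show ?thesis
      using hit[of i] by simp
  qed
  have "(\<lambda>n. exp (- (\<pi>\<^sup>2 / 2)) ^ n) \<longlonglongrightarrow> 0"
    using \<pi> by (intro LIMSEQ_power_zero) simp
  then show "(\<lambda>n. exp (- (real n * (\<pi>\<^sup>2 / 2)))) \<longlonglongrightarrow> 0"
    by (simp add: exp_of_nat_mult[symmetric])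
  have "eventually (\<lambda>n. real (k n) / real n < \<pi> / 2) sequentially"
    using \<pi> by (intro order_tendstoD[OF k]) simp
  then show "eventually (\<lambda>n. prob {\<omega> \<in> space M. (\<Sum>i<n. indicator B (U i \<omega>)) < real (k n)}
      \<le> exp (- (real n * (\<pi>\<^sup>2 / 2)))) sequentially"
    using eventually_gt_at_top[of 0]
  proof eventually_elim
    case (elim n)
    have kn: "real (k n) \<le> real n * \<pi> - real n * \<pi> / 2"
      using elim by (simp add: field_simps)
    interpret H: Hoeffding_ineq M "{..<n}" "\<lambda>i \<omega>. indicator B (U i \<omega>)" "\<lambda>_. 0" "\<lambda>_. 1"
      "\<Sum>i<n. expectation (\<lambda>\<omega>. indicator B (U i \<omega>))"
    proof unfold_locales
      show "indep_vars (\<lambda>_. borel) (\<lambda>i \<omega>. indicator B (U i \<omega>) :: real) {..<n}"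
        by (rule indep_vars_compose2[where M' = "\<lambda>_. A" and Y = "\<lambda>_. indicator B"])
          (auto intro: indep_vars_subset[OF indep])
    qed auto
    have "prob {\<omega> \<in> space M. (\<Sum>i<n. indicator B (U i \<omega>)) < real (k n)}
        \<le> prob {\<omega> \<in> space M. (\<Sum>i<n. indicator B (U i \<omega>))
              \<le> (\<Sum>i<n. expectation (\<lambda>\<omega>. indicator B (U i \<omega>))) - real n * \<pi> / 2}"
      using kn by (intro finite_measure_mono) (auto simp: mean)
    also have "\<dots> \<le> exp (- 2 * (real n * \<pi> / 2)\<^sup>2 / (\<Sum>i<n. (1 - 0)\<^sup>2))"
      using elim \<pi> by (intro H.Hoeffding_ineq_le) auto
    also have "\<dots> = exp (- (real n * (\<pi>\<^sup>2 / 2)))"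
      using elim by (simp add: power2_eq_square field_simps)
    finally show ?case .
  qed
qed (simp add: measure_nonneg)

section \<open>Convergence of the discordance variation\<close>

theorem theorem4:
  fixes N :: "real ^ 'd \<Rightarrow> real"
    and C :: nat
    and sel :: "nat set \<Rightarrow> nat"
    and M :: "'w measure"
    and X :: "'w \<Rightarrow> real ^ 'd" and Y :: "'w \<Rightarrow> nat"
    and U :: "nat \<Rightarrow> 'w \<Rightarrow> real ^ 'd" and V :: "nat \<Rightarrow> 'w \<Rightarrow> nat"
    and p q pLM :: "real ^ 'd \<Rightarrow> nat \<Rightarrow> real"
    and \<zeta> L :: real
    and k :: "nat \<Rightarrow> nat"
    and x :: "real ^ 'd" and ystar :: nat
  assumes norm: "is_norm N"
    and tie: "tie_breaker C sel"
    and LM: "\<And>z. label_dist C (pLM z)"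
    and zeta: "\<zeta> \<ge> 0"
    and prob: "prob_space M"
    and X: "X \<in> borel_measurable M"
    and Y: "Y \<in> measurable M (count_space {1..C})"
    and p: "is_cond_dist M X Y C p"
    and indep: "prob_space.indep_vars M (\<lambda>_. borel \<Otimes>\<^sub>M count_space {1..C})
                  (\<lambda>i \<omega>. (U i \<omega>, V i \<omega>)) UNIV"
    and ident: "\<And>i. distr M (borel \<Otimes>\<^sub>M count_space {1..C}) (\<lambda>\<omega>. (U i \<omega>, V i \<omega>))
                  = distr M (borel \<Otimes>\<^sub>M count_space {1..C}) (\<lambda>\<omega>. (U 0 \<omega>, V 0 \<omega>))"
    and q: "is_cond_dist M (U 0) (V 0) C q"
    and aligned_marginal: "distr M borel X = distr M borel (U 0)"
    and aligned_cond: "p = q"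
    and x: "x \<in> measure_support (distr M borel (U 0))"
    and bayes_unique: "{y. is_arg_max (p x) (\<lambda>y. y \<in> {1..C}) y} = {ystar}"
    and L: "L > 0"
    and lipschitz: "lipschitz_cond N C L p"
    and k_range: "\<And>n. n \<ge> 1 \<Longrightarrow> 1 \<le> k n \<and> k n \<le> n"
    and k_infinity: "filterlim k at_top sequentially"
    and k_over_n: "(\<lambda>n. real (k n) / real n) \<longlonglongrightarrow> 0"
  shows "tendsto_in_prob M
           (\<lambda>n \<omega>. disc_variation N C sel n (k n) (\<lambda>i. U i \<omega>) (\<lambda>i. V i \<omega>) pLM
                    (opt_gate N C \<zeta> n (k n) (\<lambda>i. U i \<omega>) (\<lambda>i. V i \<omega>) p pLM) x)
           (limit_gate C p pLM x * (p x ystar - pLM x ystar))"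
proof -
  interpret prob_space M
    by (rule prob)
  let ?W = "borel \<Otimes>\<^sub>M count_space {1..C} :: ((real ^ 'd) \<times> nat) measure"
  have UV[measurable]: "(\<lambda>\<omega>. (U i \<omega>, V i \<omega>)) \<in> measurable M ?W" for i
    using indep by (auto simp: indep_vars_def)
  have U[measurable]: "U i \<in> borel_measurable M" for i
    using measurable_compose[OF UV measurable_fst] by simp
  have V: "V i \<in> measurable M (count_space UNIV)" for i
  proof -
    have "V i \<in> measurable M (count_space {1..C})"
      using measurable_compose[OF UV measurable_snd] by simp
    then show ?thesis
      by (rule measurable_compose) simp
  qed
  have cond: "is_cond_dist M (U i) (V i) C p" for i
    using is_cond_dist_cong_joint[OF q ident UV UV] aligned_cond by simp
  have px: "label_dist C (p x)"
    using p by (simp add: is_cond_dist_def)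
  define r where "r n \<omega> = retriever N n (k n) (\<lambda>i. U i \<omega>) (\<lambda>i. V i \<omega>) x" for n \<omega>
  define w where "w n \<omega> = trust_weight N n (k n) (\<lambda>i. U i \<omega>) x" for n \<omega>
  define G where "G n \<omega> = gated_gain C sel \<zeta> (p x) (pLM x) (r n \<omega>) (w n \<omega>)" for n \<omega>
  define c where "c = limit_gate C p pLM x * (p x ystar - pLM x ystar)"
  have G_meas[measurable]: "G n \<in> borel_measurable M" for n
    unfolding G_def[abs_def] r_def w_def by (intro measurable_gated_gain norm U V)
  have conv: "(\<lambda>n. prob {\<omega> \<in> space M. \<bar>G n \<omega> - c\<bar> > \<epsilon>}) \<longlonglongrightarrow> 0" if \<epsilon>: "0 < \<epsilon>" for \<epsilon>
  proof -
    obtain \<delta> where \<delta>: "0 < \<delta>"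
      and G_close: "\<And>n \<omega>. (\<forall>y\<in>{1..C}. \<bar>r n \<omega> y - p x y\<bar> \<le> \<delta>) \<Longrightarrow> \<bar>w n \<omega> - 1\<bar> \<le> \<delta> \<Longrightarrow> \<bar>G n \<omega> - c\<bar> \<le> \<epsilon>"
      using gated_gain_continuous[OF px LM tie bayes_unique \<epsilon>, of \<zeta> x]
      unfolding G_def c_def limit_gate_def by blast
    \<comment> \<open>The radius is small enough to move \<open>p\<close> by at most \<open>\<delta> / 2\<close> (Lipschitz bound) and each trust term by at most \<open>\<delta>\<close>.\<close>
    define \<rho> where "\<rho> = min (\<delta> / (2 * L)) (sqrt \<delta>)"
    have \<rho>: "0 < \<rho>" "L * \<rho> \<le> \<delta> / 2" "\<rho>\<^sup>2 \<le> \<delta>"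
    proof -
      show "0 < \<rho>"
        using \<delta> L by (simp add: \<rho>_def)
      have "L * \<rho> \<le> L * (\<delta> / (2 * L))"
        using L by (intro mult_left_mono) (auto simp: \<rho>_def)
      then show "L * \<rho> \<le> \<delta> / 2"
        using L by simp
      have "\<rho>\<^sup>2 \<le> (sqrt \<delta>)\<^sup>2"
        using \<open>0 < \<rho>\<close> by (intro power_mono) (auto simp: \<rho>_def)
      then show "\<rho>\<^sup>2 \<le> \<delta>"
        using \<delta> by simp
    qed
    define B where "B = {u. N (x - u) < \<rho>}"
    have B_open: "open B"
      unfolding B_def
      by (intro open_Collect_less continuous_on_compose2[OF continuous_on_is_norm[OF norm]] continuous_intros) auto
    then have B[measurable]: "B \<in> sets borel"
      by simp
    define \<pi> where "\<pi> = prob {\<omega> \<in> space M. U 0 \<omega> \<in> B}"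
    have "N 0 = 0"
      using norm unfolding is_norm_def by blast
    then have "x \<in> B"
      using \<rho>(1) by (simp add: B_def)
    then have "0 < emeasure (distr M borel (U 0)) B"
      using x B_open by (simp add: measure_support_def)
    also have "emeasure (distr M borel (U 0)) B = ennreal \<pi>"
      by (simp add: emeasure_distr vimage_def Int_def conj_commute emeasure_eq_measure \<pi>_def)
    finally have \<pi>: "0 < \<pi>"
      by simp
    have hit: "prob {\<omega> \<in> space M. U i \<omega> \<in> B} = \<pi>" for i
    proof -
      have ev: "prob {\<omega> \<in> space M. U j \<omega> \<in> B} = measure (distr M ?W (\<lambda>\<omega>. (U j \<omega>, V j \<omega>))) {a \<in> space ?W. fst a \<in> B}" for j
      proof -
        have "{a \<in> space ?W. fst a \<in> B} \<in> sets ?W"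
          by measurable
        then have "measure (distr M ?W (\<lambda>\<omega>. (U j \<omega>, V j \<omega>))) {a \<in> space ?W. fst a \<in> B}
            = prob ((\<lambda>\<omega>. (U j \<omega>, V j \<omega>)) -` {a \<in> space ?W. fst a \<in> B} \<inter> space M)"
          by (rule measure_distr[OF UV])
        also have "(\<lambda>\<omega>. (U j \<omega>, V j \<omega>)) -` {a \<in> space ?W. fst a \<in> B} \<inter> space M = {\<omega> \<in> space M. U j \<omega> \<in> B}"
          using measurable_space[OF UV[of j]] by auto
        finally show ?thesis ..
      qed
      show ?thesis
        unfolding \<pi>_def ev ident[of i] ..
    qed
    \<comment> \<open>The two sources of error: a ball with fewer than \<open>k n\<close> points, and label frequencies away from their local mean.\<close>
    define Few where "Few n = {\<omega> \<in> space M. (\<Sum>i<n. indicator B (U i \<omega>)) < real (k n)}" for n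
    define R where "R n y \<omega> = r n \<omega> y - (\<Sum>j<k n. p (U (nn_index N n (\<lambda>i. U i \<omega>) x j) \<omega>) y) / real (k n)" for n y \<omega>
    define Off where "Off n y = {\<omega> \<in> space M. \<delta> / 2 \<le> \<bar>R n y \<omega>\<bar>}" for n y
    have "indep_vars (\<lambda>_. borel) U UNIV"
      using indep_vars_compose2[OF indep, of "\<lambda>_. fst" "\<lambda>_. borel"] by simp
    then have Few_0: "(\<lambda>n. prob (Few n)) \<longlonglongrightarrow> 0"
      unfolding Few_def by (rule few_hits_prob_tendsto_0[OF _ B hit \<pi> k_over_n])
    have Few_meas: "Few n \<in> events" for n
      unfolding Few_def by measurable
    have off: "Off n y \<in> events \<and> prob (Off n y) \<le> 1 / (real (k n) * (\<delta> / 2)\<^sup>2)"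
      if y: "y \<in> {1..C}" and n: "1 \<le> n" for n y
    proof -
      have kn: "0 < k n" "k n \<le> n"
        using k_range[OF n] by auto
      have [measurable]: "R n y \<in> borel_measurable M" and "prob (Off n y) \<le> 1 / (real (k n) * (\<delta> / 2)\<^sup>2)"
        using retriever_concentration[OF norm indep cond y kn half_gt_zero[OF \<delta>], of x]
        unfolding Off_def R_def[abs_def] r_def by blast+
      then show ?thesis
        unfolding Off_def by simp
    qed
    have cover: "{\<omega> \<in> space M. \<bar>G n \<omega> - c\<bar> > \<epsilon>} \<subseteq> Few n \<union> (\<Union>y\<in>{1..C}. Off n y)" if n: "1 \<le> n" for n
    proof
      fix \<omega> assume \<omega>: "\<omega> \<in> {\<omega> \<in> space M. \<bar>G n \<omega> - c\<bar> > \<epsilon>}"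
      show "\<omega> \<in> Few n \<union> (\<Union>y\<in>{1..C}. Off n y)"
      proof (rule ccontr)
        assume "\<omega> \<notin> Few n \<union> (\<Union>y\<in>{1..C}. Off n y)"
        with \<omega> have many: "real (k n) \<le> (\<Sum>i<n. indicator B (U i \<omega>))"
          and on: "\<And>y. y \<in> {1..C} \<Longrightarrow> \<bar>R n y \<omega>\<bar> < \<delta> / 2"
          by (auto simp: Few_def Off_def not_less not_le)
        have kn: "0 < k n" "k n \<le> n"
          using k_range[OF n] by auto
        let ?nn = "nn_index N n (\<lambda>i. U i \<omega>) x"
        have "(\<Sum>i<n. indicator B (U i \<omega>)) = (\<Sum>i<n. if N (x - U i \<omega>) < \<rho> then 1 else 0 :: real)"
          by (intro sum.cong) (auto simp: B_def)
        also have "\<dots> = real (card {i. i < n \<and> N (x - U i \<omega>) < \<rho>})"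
          by (simp add: sum.If_cases Int_def)
        finally have "k n \<le> card {i. i < n \<and> N (x - U i \<omega>) < \<rho>}"
          using many by simp
        then have near: "N (x - U (?nn j) \<omega>) < \<rho>" if "j < k n" for j
          using kn(2) that by (intro neighbours_in_ball[of "k n" n N x "\<lambda>i. U i \<omega>"]) (auto simp: neighbours_def)
        have "\<bar>r n \<omega> y - p x y\<bar> \<le> \<delta>" if y: "y \<in> {1..C}" for y
        proof -
          have "\<bar>(\<Sum>j<k n. p (U (?nn j) \<omega>) y) / real (k n) - p x y\<bar> \<le> \<delta> / 2"
          proof (rule average_close[OF kn(1)])
            fix j assume "j < k n"
            have "\<bar>p x y - p (U (?nn j) \<omega>) y\<bar> \<le> L * N (x - U (?nn j) \<omega>)"
              using lipschitz y by (simp add: lipschitz_cond_def)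
            also have "\<dots> \<le> L * \<rho>"
              using near[OF \<open>j < k n\<close>] L by simp
            finally show "\<bar>p (U (?nn j) \<omega>) y - p x y\<bar> \<le> \<delta> / 2"
              using \<rho>(2) by linarith
          qed
          then show ?thesis
            using on[OF y] unfolding R_def by linarith
        qed
        moreover have "\<bar>w n \<omega> - 1\<bar> \<le> \<delta>"
          unfolding w_def trust_weight_def
        proof (rule average_close[OF kn(1)])
          fix j assume "j < k n"
          then have "(N (x - U (?nn j) \<omega>))\<^sup>2 \<le> \<rho>\<^sup>2"
            using near is_norm_nonneg[OF norm] by (intro power_mono) (auto intro: less_imp_le)
          \<comment> \<open>The elementary bound \<open>1 - t \<le> exp (- t) \<le> 1\<close> with \<open>t\<close> the squared distance, which is at most \<open>\<rho>\<^sup>2 \<le> \<delta>\<close>.\<close>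
          moreover have "exp (- (N (x - U (?nn j) \<omega>))\<^sup>2) \<le> 1"
            by simp
          ultimately show "\<bar>exp (- (N (x - U (?nn j) \<omega>))\<^sup>2) - 1\<bar> \<le> \<delta>"
            using exp_ge_add_one_self[of "- (N (x - U (?nn j) \<omega>))\<^sup>2"] \<rho>(3) by linarith
        qed
        ultimately have "\<bar>G n \<omega> - c\<bar> \<le> \<epsilon>"
          by (intro G_close) auto
        with \<omega> show False
          by simp
      qed
    qed
    have bound: "prob {\<omega> \<in> space M. \<bar>G n \<omega> - c\<bar> > \<epsilon>}
        \<le> prob (Few n) + real C * (1 / (real (k n) * (\<delta> / 2)\<^sup>2))" if n: "1 \<le> n" for n
    proof -
      have "prob {\<omega> \<in> space M. \<bar>G n \<omega> - c\<bar> > \<epsilon>} \<le> prob (Few n \<union> (\<Union>y\<in>{1..C}. Off n y))"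
        using off[OF _ n] Few_meas by (intro finite_measure_mono cover n sets.Un sets.finite_UN) auto
      also have "\<dots> \<le> prob (Few n) + prob (\<Union>y\<in>{1..C}. Off n y)"
        using off[OF _ n] Few_meas by (intro measure_Un_le sets.finite_UN) auto
      also have "prob (\<Union>y\<in>{1..C}. Off n y) \<le> (\<Sum>y\<in>{1..C}. prob (Off n y))"
        using off[OF _ n] by (intro finite_measure_subadditive_finite) auto
      also have "\<dots> \<le> (\<Sum>y\<in>{1..C}. 1 / (real (k n) * (\<delta> / 2)\<^sup>2))"
        using off[OF _ n] by (intro sum_mono) auto
      finally show ?thesis
        by simp
    qed
    have "filterlim (\<lambda>n. real (k n)) at_top sequentially"
      by (rule filterlim_compose[OF filterlim_real_sequentially k_infinity])
    then have "(\<lambda>n. inverse (real (k n))) \<longlonglongrightarrow> 0"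
      by (rule tendsto_inverse_0_at_top)
    then have "(\<lambda>n. prob (Few n) + real C / (\<delta> / 2)\<^sup>2 * inverse (real (k n))) \<longlonglongrightarrow> 0 + real C / (\<delta> / 2)\<^sup>2 * 0"
      by (intro tendsto_add Few_0 tendsto_mult_left)
    then have lim: "(\<lambda>n. prob (Few n) + real C * (1 / (real (k n) * (\<delta> / 2)\<^sup>2))) \<longlonglongrightarrow> 0"
      by (simp add: field_simps)
    show ?thesis
    proof (rule tendsto_sandwich[OF _ _ tendsto_const lim])
      show "eventually (\<lambda>n. prob {\<omega> \<in> space M. \<bar>G n \<omega> - c\<bar> > \<epsilon>}
          \<le> prob (Few n) + real C * (1 / (real (k n) * (\<delta> / 2)\<^sup>2))) sequentially"
        using eventually_ge_at_top[of 1] by eventually_elim (rule bound)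
    qed (simp add: measure_nonneg)
  qed
  show ?thesis
    unfolding tendsto_in_prob_def disc_variation_opt_gate
    using G_meas conv unfolding G_def[abs_def] r_def w_def c_def by blast
qed

end
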